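(* Let $p\ge5$ be a prime, $k>1$, $A=\mathbb{Z}_p^k$, and let $T$ be a caterpillar with spine path $s_1s_2s_3$ and $|V(T)|=p^k$, where $X,Y,Z$ are the sets of leaves attached to $s_1,s_2,s_3$ respectively. Let $\alpha,\beta,\gamma\in\{0,1,\dots,p-1\}$ be the residues of $|X|,|Y|,|Z|$ modulo $p$. Then $T$ is $A$-rainbow if and only if none of the following holds: 1. $\beta=p-2$ and either ($\alpha=0$, $\gamma=p-1$) or ($\alpha=p-1$, $\gamma=0$); 2. $|Y|=0$ and either ($\alpha=p-1$, $\gamma=p-2$) or ($\alpha=p-2$, $\gamma=p-1$); 3. $|Y|=1$ and either ($\alpha=p-1$, $\gamma=p-3$) or ($\alpha=p-3$, $\gamma=p-1$).
   Context: For an Abelian group $A$ and a tree $T$ with $|V(T)|=|A|$, a labeling $f\colon V(T)\to A$ induces the edge labeling $uv\mapsto f(u)+f(v)$. $f$ is an $A$-rainbow labeling if $f$ is a bijection and all edges receive distinct labels; $T$ is $A$-rainbow if it admits such a labeling. A caterpillar with three spine vertices is the path $s_1s_2s_3$ with some number of leaves attached to each $s_i$. *)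

theory Defs
  imports
    "HOL-Algebra.FiniteProduct"
    "HOL-Algebra.Elementary_Groups"
    "HOL-Algebra.Product_Groups"
    "HOL-Computational_Algebra.Primes"
begin

text \<open>
  Graphs are given by a vertex set and a set of two-element edges. Abelian groups are written
  multiplicatively in \<open>HOL-Algebra\<close>, so the sum \<open>f(u) + f(v)\<close> over an edge \<open>{u, v}\<close> appears as
  a \<^const>\<open>finprod\<close> over that edge.
\<close>

definition edge_label :: "('g, 'm) monoid_scheme \<Rightarrow> ('v \<Rightarrow> 'g) \<Rightarrow> 'v set \<Rightarrow> 'g" where
  "edge_label G f e = finprod G f e"

lemma (in comm_monoid) edge_label_pair:
  assumes "u \<noteq> v" "f u \<in> carrier G" "f v \<in> carrier G"
  shows "edge_label G f {u, v} = f u \<otimes> f v"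
  using assms by (simp add: edge_label_def)

definition rainbow_labeling ::
  "('g, 'm) monoid_scheme \<Rightarrow> 'v set \<Rightarrow> 'v set set \<Rightarrow> ('v \<Rightarrow> 'g) \<Rightarrow> bool" where
  "rainbow_labeling G V E f \<longleftrightarrow> bij_betw f V (carrier G) \<and> inj_on (edge_label G f) E"

definition rainbow :: "('g, 'm) monoid_scheme \<Rightarrow> 'v set \<Rightarrow> 'v set set \<Rightarrow> bool" where
  "rainbow G V E \<longleftrightarrow> (\<exists>f. rainbow_labeling G V E f)"

text \<open>Each of the leaf sets \<open>X\<close>, \<open>Y\<close>, \<open>Z\<close> may be empty.\<close>

definition caterpillar3 ::
  "'v set \<Rightarrow> 'v set set \<Rightarrow> 'v \<Rightarrow> 'v \<Rightarrow> 'v \<Rightarrow> 'v set \<Rightarrow> 'v set \<Rightarrow> 'v set \<Rightarrow> bool" where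
  "caterpillar3 V E s1 s2 s3 X Y Z \<longleftrightarrow>
     distinct [s1, s2, s3] \<and>
     {s1, s2, s3} \<inter> (X \<union> Y \<union> Z) = {} \<and>
     X \<inter> Y = {} \<and> X \<inter> Z = {} \<and> Y \<inter> Z = {} \<and>
     V = {s1, s2, s3} \<union> X \<union> Y \<union> Z \<and>
     E = {{s1, s2}, {s2, s3}} \<union> (\<lambda>x. {s1, x}) ` X \<union> (\<lambda>y. {s2, y}) ` Y \<union> (\<lambda>z. {s3, z}) ` Z"

definition Zmod_power :: "nat \<Rightarrow> nat \<Rightarrow> (nat \<Rightarrow> int) monoid" where
  "Zmod_power p k = product_group {..<k} (\<lambda>_. integer_mod_group p)"

end

theory Submission
  imports Defs "HOL-Algebra.Multiplicative_Group" "HOL-Number_Theory.Cong"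
begin

text \<open>
  Translating the labels so that \<open>s2\<close> is labelled \<open>0\<close>, let \<open>a\<close>, \<open>b\<close> be the labels of \<open>s1\<close>, \<open>s3\<close>.
  A labelling is rainbow iff the map that adds \<open>a\<close> to the labels of \<open>X\<close>, adds \<open>b\<close> to the labels
  of \<open>Z\<close> and fixes all other labels is injective on the nonzero elements. It then misses exactly one
  element \<open>m\<close>, and summing over the group gives \<open>m = - (|X| a + |Z| b)\<close>. The exceptional cases
  violate this: in the first, \<open>m\<close> is one of the fixed labels \<open>a\<close>, \<open>b\<close>; in the others, \<open>a + b\<close>
  can only be hit if it is a label of \<open>Y\<close>, and if it is the only one then the counts in the cosets of
  \<open>a - b\<close> do not add up.

  Otherwise \<open>a\<close> and \<open>b\<close> can, with one exception, be chosen in a common subgroup of order \<open>p\<close>. On a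
  coset other than the subgroup any \<open>x\<close> translations by \<open>a\<close> and \<open>z\<close> by \<open>b\<close> with \<open>x + z \<le> p\<close> and
  \<open>x a + z b = 0\<close> are possible, by exchanging two adjacent intervals after rescaling. The subgroup
  and one or two further cosets realise the residues modulo \<open>p\<close>, and each remaining coset lies
  entirely in the labels of \<open>X\<close>, of \<open>Y\<close> or of \<open>Z\<close>.
\<close>

section \<open>Reduction to a partial translation map\<close>

definition shift :: "('g, 'm) monoid_scheme \<Rightarrow> 'g \<Rightarrow> 'g \<Rightarrow> 'g set \<Rightarrow> 'g set \<Rightarrow> 'g \<Rightarrow> 'g" where
  "shift G a b S T v = (if v \<in> S then v \<otimes>\<^bsub>G\<^esub> a else if v \<in> T then v \<otimes>\<^bsub>G\<^esub> b else v)"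

text \<open>\<open>S\<close> and \<open>T\<close> are the labels of \<open>X\<close> and
  \<open>Z\<close>; the labels of \<open>Y\<close> are whatever remains. A label other than
  \<open>\<one>\<close> stands for the edge leading from its vertex towards \<open>s2\<close>, so
  \<open>\<one>\<close> is outside the domain, and \<open>a\<close> and \<open>b\<close>, standing
  for the two spine edges, have to be fixed points.\<close>

definition rooted_shift ::
  "('g, 'm) monoid_scheme \<Rightarrow> 'g \<Rightarrow> 'g \<Rightarrow> 'g set \<Rightarrow> 'g set \<Rightarrow> bool" where
  "rooted_shift G a b S T \<longleftrightarrow>
     a \<in> carrier G - {\<one>\<^bsub>G\<^esub>} \<and> b \<in> carrier G - {\<one>\<^bsub>G\<^esub>} \<and> a \<noteq> b \<and>
     S \<subseteq> carrier G - {\<one>\<^bsub>G\<^esub>, a, b} \<and> T \<subseteq> carrier G - {\<one>\<^bsub>G\<^esub>, a, b} \<and> S \<inter> T = {} \<and>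
     inj_on (shift G a b S T) (carrier G - {\<one>\<^bsub>G\<^esub>})"

definition rooted :: "('g, 'm) monoid_scheme \<Rightarrow> nat \<Rightarrow> nat \<Rightarrow> bool" where
  "rooted G x z \<longleftrightarrow> (\<exists>a b S T. rooted_shift G a b S T \<and> card S = x \<and> card T = z)"

lemma caterpillar3_swap:
  "caterpillar3 V E s1 s2 s3 X Y Z \<Longrightarrow> caterpillar3 V E s3 s2 s1 Z Y X"
  unfolding caterpillar3_def by (auto simp: insert_commute)

context comm_group
begin

text \<open>An edge has exactly two ends, so all edge labels change by the same factor
  \<open>c \<otimes> c\<close> and stay distinct. This permits normalising the label of
  \<open>s2\<close> to \<open>\<one>\<close>.\<close>

lemma rainbow_labeling_translate:
  assumes f: "rainbow_labeling G V E f" and c: "c \<in> carrier G"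
    and E: "\<And>e. e \<in> E \<Longrightarrow> e \<subseteq> V \<and> card e = 2"
  shows "rainbow_labeling G V E (\<lambda>v. f v \<otimes> c)"
proof -
  have bij: "bij_betw f V (carrier G)" and inj: "inj_on (edge_label G f) E"
    using f by (auto simp: rainbow_labeling_def)
  have fc: "f v \<in> carrier G" if "v \<in> V" for v
    using bij that by (auto simp: bij_betw_def)
  have "bij_betw (\<lambda>x. x \<otimes> c) (carrier G) (carrier G)"
    by (rule bij_betw_byWitness[where f' = "\<lambda>x. x \<otimes> inv c"]) (auto simp: c m_assoc)
  then have bij': "bij_betw (\<lambda>v. f v \<otimes> c) V (carrier G)"
    using bij_betw_trans[OF bij] by (simp add: o_def)
  have lab: "edge_label G (\<lambda>v. f v \<otimes> c) e = edge_label G f e \<otimes> (c \<otimes> c)"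
    and lab_carrier: "edge_label G f e \<in> carrier G" if "e \<in> E" for e
  proof -
    have "e \<subseteq> V" "card e = 2" using E[OF that] by auto
    then obtain u v where e: "e = {u, v}" "u \<noteq> v" by (auto simp: card_2_iff)
    then have uv: "f u \<in> carrier G" "f v \<in> carrier G" using \<open>e \<subseteq> V\<close> fc by auto
    show "edge_label G (\<lambda>v. f v \<otimes> c) e = edge_label G f e \<otimes> (c \<otimes> c)"
      using e uv c by (simp add: edge_label_pair m_ac)
    show "edge_label G f e \<in> carrier G" using e uv by (simp add: edge_label_pair)
  qed
  have "inj_on (edge_label G (\<lambda>v. f v \<otimes> c)) E"
    using inj lab lab_carrier c unfolding inj_on_def by simp
  then show ?thesis using bij' by (simp add: rainbow_labeling_def)
qed

lemma rainbow_labeling_iff_shift: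
  assumes cat: "caterpillar3 V E s1 s2 s3 X Y Z"
    and bij: "bij_betw g V (carrier G)" and root: "g s2 = \<one>"
  shows "rainbow_labeling G V E g \<longleftrightarrow>
    inj_on (shift G (g s1) (g s3) (g ` X) (g ` Z)) (carrier G - {\<one>})"
proof -
  \<comment> \<open>\<open>ed v\<close> is the first edge on the path from \<open>v\<close> to
    \<open>s2\<close>; it indexes the edges by the vertices other than \<open>s2\<close>.\<close>
  define ed where "ed v = (if v = s1 then {s1, s2} else if v = s3 then {s2, s3}
    else if v \<in> X then {s1, v} else if v \<in> Y then {s2, v} else {s3, v})" for v
  have V: "V = {s1, s2, s3} \<union> X \<union> Y \<union> Z"
    and E: "E = {{s1, s2}, {s2, s3}} \<union> (\<lambda>x. {s1, x}) ` X \<union> (\<lambda>y. {s2, y}) ` Y \<union> (\<lambda>z. {s3, z}) ` Z"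
    and D: "distinct [s1, s2, s3]" "{s1, s2, s3} \<inter> (X \<union> Y \<union> Z) = {}"
      "X \<inter> Y = {}" "X \<inter> Z = {}" "Y \<inter> Z = {}"
    using cat by (simp_all add: caterpillar3_def)
  have Vs: "V - {s2} = {s1, s3} \<union> X \<union> Y \<union> Z" using V D by auto
  have "ed ` X = (\<lambda>x. {s1, x}) ` X" "ed ` Y = (\<lambda>y. {s2, y}) ` Y" "ed ` Z = (\<lambda>z. {s3, z}) ` Z"
    using D by (auto simp: ed_def intro!: image_cong)
  then have E_ed: "E = ed ` (V - {s2})"
    unfolding E Vs image_Un using D by (auto simp: ed_def)
  have inj_ed: "inj_on ed (V - {s2})"
    unfolding Vs inj_on_def ed_def using D by (auto simp: doubleton_eq_iff)
  have gc: "g v \<in> carrier G" if "v \<in> V" for v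
    using bij that by (auto simp: bij_betw_def)
  have inj: "inj_on g V" using bij by (simp add: bij_betw_def)
  have img: "g ` (V - {s2}) = carrier G - {\<one>}"
    using inj_on_image_set_diff[OF inj, of V "{s2}"] V bij root by (simp add: bij_betw_def)
  have mem: "g v \<in> g ` W \<longleftrightarrow> v \<in> W" if "v \<in> V" "W \<subseteq> V" for v W
    using inj that by (auto simp: inj_on_def)
  have "edge_label G g (ed v) = shift G (g s1) (g s3) (g ` X) (g ` Z) (g v)" if v: "v \<in> V - {s2}" for v
  proof -
    have sub: "X \<subseteq> V" "Z \<subseteq> V" "s1 \<in> V" "s2 \<in> V" "s3 \<in> V" "v \<in> V" using V v by auto
    have gin: "g v \<in> carrier G" "g s1 \<in> carrier G" "g s3 \<in> carrier G" using gc sub by auto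
    have sh: "shift G (g s1) (g s3) (g ` X) (g ` Z) (g v) =
      (if v \<in> X then g v \<otimes> g s1 else if v \<in> Z then g v \<otimes> g s3 else g v)"
      unfolding shift_def using mem[OF \<open>v \<in> V\<close>] sub by simp
    consider "v = s1" | "v = s3" | "v \<in> X" | "v \<in> Y" | "v \<in> Z" using v Vs by auto
    then show ?thesis
    proof cases
      case 1 then show ?thesis unfolding sh using D gin root
        by (auto simp: ed_def edge_label_pair)
    next
      case 2 then show ?thesis unfolding sh using D gin root
        by (auto simp: ed_def edge_label_pair)
    next
      case 3
      then have "v \<noteq> s1" "v \<noteq> s3" using D by auto
      then show ?thesis unfolding sh using 3 gin by (simp add: ed_def edge_label_pair m_comm)
    next
      case 4
      then have "v \<noteq> s1" "v \<noteq> s3" "v \<noteq> s2" "v \<notin> X" "v \<notin> Z" using D by auto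
      then show ?thesis unfolding sh using 4 gin root by (simp add: ed_def edge_label_pair)
    next
      case 5
      then have "v \<noteq> s1" "v \<noteq> s3" "v \<notin> X" "v \<notin> Y" using D by auto
      then show ?thesis unfolding sh using 5 gin by (simp add: ed_def edge_label_pair m_comm)
    qed
  qed
  then have "inj_on (edge_label G g \<circ> ed) (V - {s2}) \<longleftrightarrow>
      inj_on (shift G (g s1) (g s3) (g ` X) (g ` Z) \<circ> g) (V - {s2})"
    by (intro inj_on_cong) auto
  also have "\<dots> \<longleftrightarrow> inj_on (shift G (g s1) (g s3) (g ` X) (g ` Z)) (carrier G - {\<one>})"
    using comp_inj_on_iff[OF inj_on_subset[OF inj, of "V - {s2}"]] img by auto
  finally have "inj_on (edge_label G g) E \<longleftrightarrow>
      inj_on (shift G (g s1) (g s3) (g ` X) (g ` Z)) (carrier G - {\<one>})"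
    unfolding E_ed using comp_inj_on_iff[OF inj_ed] by auto
  then show ?thesis using bij by (simp add: rainbow_labeling_def)
qed

text \<open>Leaves at the same spine vertex are interchangeable: any bijections from
  \<open>X\<close>, \<open>Y\<close>, \<open>Z\<close> onto the prescribed label sets will do, so
  only the sizes of the leaf sets matter.\<close>

lemma rainbow_iff_rooted:
  assumes cat: "caterpillar3 V E s1 s2 s3 X Y Z"
    and fin: "finite V" and card: "card V = card (carrier G)"
  shows "rainbow G V E \<longleftrightarrow> rooted G (card X) (card Z)"
proof
  have V: "V = {s1, s2, s3} \<union> X \<union> Y \<union> Z"
    and D: "distinct [s1, s2, s3]" "{s1, s2, s3} \<inter> (X \<union> Y \<union> Z) = {}"
      "X \<inter> Y = {}" "X \<inter> Z = {}" "Y \<inter> Z = {}"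
    and E: "E = {{s1, s2}, {s2, s3}} \<union> (\<lambda>x. {s1, x}) ` X \<union> (\<lambda>y. {s2, y}) ` Y \<union> (\<lambda>z. {s3, z}) ` Z"
    using cat by (simp_all add: caterpillar3_def)
  have E2: "e \<subseteq> V \<and> card e = 2" if "e \<in> E" for e
    using that D unfolding E V by (auto simp: card_insert_if)
  {
    assume "rainbow G V E"
    then obtain f where f: "rainbow_labeling G V E f" by (auto simp: rainbow_def)
    define g where "g v = f v \<otimes> inv (f s2)" for v
    have bf: "bij_betw f V (carrier G)" using f by (simp add: rainbow_labeling_def)
    then have s2: "f s2 \<in> carrier G" using V by (auto simp: bij_betw_def)
    have rg: "rainbow_labeling G V E g"
      unfolding g_def using rainbow_labeling_translate[OF f _ E2] s2 by simp
    then have bg: "bij_betw g V (carrier G)" by (simp add: rainbow_labeling_def)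
    have root: "g s2 = \<one>" using s2 by (simp add: g_def)
    have inj: "inj_on g V" using bg by (simp add: bij_betw_def)
    have gc: "g ` V = carrier G" using bg by (simp add: bij_betw_def)
    have neq: "g u \<noteq> g v" if "u \<in> V" "v \<in> V" "u \<noteq> v" for u v
      using inj that by (auto simp: inj_on_def)
    have "rooted_shift G (g s1) (g s3) (g ` X) (g ` Z)"
      unfolding rooted_shift_def
    proof (intro conjI)
      show "inj_on (shift G (g s1) (g s3) (g ` X) (g ` Z)) (carrier G - {\<one>})"
        using rainbow_labeling_iff_shift[OF cat bg root] rg by simp
      show "g s1 \<in> carrier G - {\<one>}" "g s3 \<in> carrier G - {\<one>}" "g s1 \<noteq> g s3"
        using neq[of s1 s2] neq[of s3 s2] neq[of s1 s3] root gc V D by auto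
      show "g ` X \<subseteq> carrier G - {\<one>, g s1, g s3}" "g ` Z \<subseteq> carrier G - {\<one>, g s1, g s3}"
        unfolding root[symmetric] gc[symmetric]
        using inj_on_image_set_diff[OF inj, of V "{s2, s1, s3}"] V D by auto
      show "g ` X \<inter> g ` Z = {}"
        using inj_on_image_Int[OF inj, of X Z] V D by auto
    qed
    moreover have "card (g ` X) = card X" "card (g ` Z) = card Z"
      using inj V by (auto intro!: card_image inj_on_subset[OF inj])
    ultimately show "rooted G (card X) (card Z)" unfolding rooted_def by blast
  }
  assume "rooted G (card X) (card Z)"
  then obtain a b S T where r: "rooted_shift G a b S T" and c: "card S = card X" "card T = card Z"
    unfolding rooted_def by blast
  have finG: "finite (carrier G)"
    using card fin V by (metis card_eq_0_iff card_ge_0_finite empty_iff gr0I insertI1 UnI1)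
  have ab: "a \<in> carrier G" "a \<noteq> \<one>" "b \<in> carrier G" "b \<noteq> \<one>" "a \<noteq> b"
    and ST: "S \<subseteq> carrier G - {\<one>, a, b}" "T \<subseteq> carrier G - {\<one>, a, b}" "S \<inter> T = {}"
    and inj: "inj_on (shift G a b S T) (carrier G - {\<one>})"
    using r by (auto simp: rooted_shift_def)
  have finS: "finite S" "finite T" using ST finG by (auto intro: finite_subset)
  have finX: "finite X" "finite Y" "finite Z" using fin V by auto
  define U where "U = carrier G - ({\<one>, a, b} \<union> S \<union> T)"
  have finU: "finite U" using finG by (simp add: U_def)
  have part: "carrier G = {\<one>, a, b} \<union> S \<union> T \<union> U" using ab ST by (auto simp: U_def)
  have "card (carrier G) = 3 + card S + card T + card U"
  proof -
    have "card ({\<one>, a, b} \<union> S \<union> T \<union> U) = card ({\<one>, a, b} \<union> S \<union> T) + card U"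
      using finS finU by (intro card_Un_disjoint) (auto simp: U_def)
    also have "card ({\<one>, a, b} \<union> S \<union> T) = card ({\<one>, a, b} \<union> S) + card T"
      using finS ST by (intro card_Un_disjoint) auto
    also have "card ({\<one>, a, b} \<union> S) = card {\<one>, a, b} + card S"
      using finS ST by (intro card_Un_disjoint) auto
    finally show ?thesis using part ab by simp
  qed
  moreover have "card V = 3 + card X + card Z + card Y"
  proof -
    have "card ({s1, s2, s3} \<union> X \<union> Y \<union> Z) = card ({s1, s2, s3} \<union> X \<union> Y) + card Z"
      using finX D by (intro card_Un_disjoint) auto
    also have "card ({s1, s2, s3} \<union> X \<union> Y) = card ({s1, s2, s3} \<union> X) + card Y"
      using finX D by (intro card_Un_disjoint) auto
    also have "card ({s1, s2, s3} \<union> X) = card {s1, s2, s3} + card X"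
      using finX D by (intro card_Un_disjoint) auto
    finally show ?thesis using V D by simp
  qed
  ultimately have "card U = card Y" using c card by simp
  then obtain hx hy hz where h: "bij_betw hx X S" "bij_betw hy Y U" "bij_betw hz Z T"
    using finite_same_card_bij finX finS finU c by metis
  define g where "g v = (if v = s1 then a else if v = s2 then \<one> else if v = s3 then b
    else if v \<in> X then hx v else if v \<in> Y then hy v else hz v)" for v
  have bX: "bij_betw g X S" using h(1) D by (subst bij_betw_cong[of _ _ hx]) (auto simp: g_def)
  have bY: "bij_betw g Y U" using h(2) D by (subst bij_betw_cong[of _ _ hy]) (auto simp: g_def)
  have bZ: "bij_betw g Z T" using h(3) D by (subst bij_betw_cong[of _ _ hz]) (auto simp: g_def)
  have b0: "bij_betw g {s1, s2, s3} {\<one>, a, b}"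
    using D ab by (auto simp: bij_betw_def g_def inj_on_def)
  have "bij_betw g ({s1, s2, s3} \<union> X \<union> Z \<union> Y) ({\<one>, a, b} \<union> S \<union> T \<union> U)"
    using b0 bX bY bZ ST by (intro bij_betw_combine) (auto simp: U_def)
  then have bg: "bij_betw g V (carrier G)"
    unfolding V part by (simp add: Un_ac)
  have gs: "g s1 = a" "g s2 = \<one>" "g s3 = b" "g ` X = S" "g ` Z = T"
    using D bX bZ by (auto simp: g_def bij_betw_def)
  then have "rainbow_labeling G V E g"
    using rainbow_labeling_iff_shift[OF cat bg] inj by simp
  then show "rainbow G V E" by (auto simp: rainbow_def)
qed

end

section \<open>The exceptional cases\<close>

context comm_group
begin

text \<open>The shift is injective on one element fewer than \<open>H\<close> has, so it misses a
  single \<open>m\<close>. Its values multiply to the product of \<open>H\<close> times one factor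
  \<open>a\<close> per element of \<open>S\<close> and one factor \<open>b\<close> per element of
  \<open>T\<close>, but also to the product of \<open>H\<close> without \<open>m\<close>. A subgroup
  is allowed in place of the whole group, because the argument is also applied to the subgroup
  generated by \<open>a \<otimes> inv b\<close>.\<close>

lemma shift_image_subgroup:
  assumes H: "subgroup H G" "finite H" and ab: "a \<in> H" "b \<in> H"
    and ST: "S \<subseteq> H - {\<one>, a, b}" "T \<subseteq> H - {\<one>, a, b}" "S \<inter> T = {}"
    and inj: "inj_on (shift G a b S T) (H - {\<one>})"
  obtains m where "m \<in> H" "shift G a b S T ` (H - {\<one>}) = H - {m}"
    "m \<otimes> (a [^] card S \<otimes> b [^] card T) = \<one>"
proof -
  define \<phi> where "\<phi> = shift G a b S T"
  have HG: "H \<subseteq> carrier G" and one: "\<one> \<in> H" using H by (auto simp: subgroup_def)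
  have ab': "a \<in> carrier G" "b \<in> carrier G" using ab HG by auto
  have "\<phi> v \<in> H" if "v \<in> H" for v
    using that ab subgroup.m_closed[OF H(1)] by (auto simp: \<phi>_def shift_def)
  then have sub: "\<phi> ` (H - {\<one>}) \<subseteq> H" by auto
  have "card (H - \<phi> ` (H - {\<one>})) = card H - card (H - {\<one>})"
    using sub H inj by (simp add: card_Diff_subset finite_subset card_image \<phi>_def)
  also have "\<dots> = 1" using one H card_gt_0_iff[of H] by (auto simp: card_Diff_singleton)
  finally obtain m where m: "H - \<phi> ` (H - {\<one>}) = {m}" by (auto simp: card_1_singleton_iff)
  have mH: "m \<in> H" using m by auto
  have img: "\<phi> ` (H - {\<one>}) = H - {m}" using m sub by auto
  define P where "P = finprod G (\<lambda>v. v) H"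
  have P: "P \<in> carrier G" unfolding P_def using HG by (intro finprod_closed) auto
  have re: "finprod G \<phi> (H - {\<one>}) = finprod G (\<lambda>v. v) (\<phi> ` (H - {\<one>}))"
  proof (rule finprod_reindex[symmetric])
    show "(\<lambda>v. v) \<in> \<phi> ` (H - {\<one>}) \<rightarrow> carrier G" using sub HG by blast
    show "inj_on \<phi> (H - {\<one>})" using inj by (simp add: \<phi>_def)
  qed
  have "m \<otimes> finprod G \<phi> (H - {\<one>}) = m \<otimes> finprod G (\<lambda>v. v) (H - {m})"
    by (simp only: re img)
  also have "\<dots> = finprod G (\<lambda>v. v) (insert m (H - {m}))"
    using H HG mH by (subst finprod_insert) auto
  also have "\<dots> = P" using mH by (simp add: P_def insert_absorb)
  finally have mP: "m \<otimes> finprod G \<phi> (H - {\<one>}) = P" .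
  have fST: "finite S" "finite T" using ST H by (auto intro: finite_subset)
  have "finprod G \<phi> (H - {\<one>}) =
      finprod G (\<lambda>v. v \<otimes> ((if v \<in> S then a else \<one>) \<otimes> (if v \<in> T then b else \<one>))) (H - {\<one>})"
    using HG ab' ST by (intro finprod_cong') (auto simp: \<phi>_def shift_def)
  also have "\<dots> = finprod G (\<lambda>v. v) (H - {\<one>}) \<otimes>
      (finprod G (\<lambda>v. if v \<in> S then a else \<one>) (H - {\<one>}) \<otimes>
       finprod G (\<lambda>v. if v \<in> T then b else \<one>) (H - {\<one>}))"
    using HG ab' by (subst finprod_multf finprod_multf; auto)+
  also have "finprod G (\<lambda>v. v) (H - {\<one>}) = P"
    unfolding P_def using finprod_insert[of "H - {\<one>}" "\<one>" "\<lambda>v. v"] H HG one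
    by (auto simp: insert_absorb Pi_iff subset_iff)
  also have "finprod G (\<lambda>v. if v \<in> S then a else \<one>) (H - {\<one>}) = finprod G (\<lambda>v. a) S"
    using ST H HG ab' by (intro finprod_mono_neutral_cong_right) auto
  also have "\<dots> = a [^] card S" using ab' by (simp add: finprod_const)
  also have "finprod G (\<lambda>v. if v \<in> T then b else \<one>) (H - {\<one>}) = finprod G (\<lambda>v. b) T"
    using ST H HG ab' by (intro finprod_mono_neutral_cong_right) auto
  also have "\<dots> = b [^] card T" using ab' by (simp add: finprod_const)
  finally have "P \<otimes> (m \<otimes> (a [^] card S \<otimes> b [^] card T)) = P"
    using mP P mH HG ab' by (simp add: m_ac subset_iff)
  then have "m \<otimes> (a [^] card S \<otimes> b [^] card T) = \<one>"
    using P mH HG ab' by (simp add: r_cancel_one subset_iff)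
  with that mH img show thesis unfolding \<phi>_def by blast
qed

lemma pow_mod_exponent:
  fixes n p :: nat
  assumes "x \<in> carrier G" "x [^] p = \<one>"
  shows "x [^] (n mod p) = x [^] n"
proof -
  have "x [^] n = x [^] (p * (n div p) + n mod p)" by simp
  also have "\<dots> = (x [^] p) [^] (n div p) \<otimes> x [^] (n mod p)"
    using assms(1) by (simp add: nat_pow_mult nat_pow_pow)
  finally show ?thesis using assms by simp
qed

text \<open>Here \<open>a [^] x = \<one>\<close> and \<open>b [^] z = inv b\<close>, so the missed
  element is \<open>b\<close>. But \<open>b\<close> is a fixed point of the shift and therefore
  hit.\<close>

lemma not_rooted_residue_0:
  assumes fin: "finite (carrier G)" and ex: "\<And>x. x \<in> carrier G \<Longrightarrow> x [^] p = \<one>"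
    and xz: "x mod p = 0" "z mod p = p - 1" and p: "p \<ge> 1"
  shows "\<not> rooted G x z"
proof
  assume "rooted G x z"
  then obtain a b S T where r: "rooted_shift G a b S T" and c: "card S = x" "card T = z"
    unfolding rooted_def by blast
  have ab: "a \<in> carrier G" "b \<in> carrier G" "b \<noteq> \<one>" and
    ST: "S \<subseteq> carrier G - {\<one>, a, b}" "T \<subseteq> carrier G - {\<one>, a, b}" "S \<inter> T = {}"
    and inj: "inj_on (shift G a b S T) (carrier G - {\<one>})"
    using r by (auto simp: rooted_shift_def)
  obtain m where m: "m \<in> carrier G" "shift G a b S T ` (carrier G - {\<one>}) = carrier G - {m}"
    "m \<otimes> (a [^] x \<otimes> b [^] z) = \<one>"
    using shift_image_subgroup[OF subgroup_self fin ab(1,2) ST inj] c by metis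
  have "a [^] x = \<one>" using pow_mod_exponent[OF ab(1) ex[OF ab(1)], of x] xz by simp
  moreover have "b [^] z \<otimes> b = \<one>"
  proof -
    have "b [^] z = b [^] (p - 1)" using pow_mod_exponent[OF ab(2) ex[OF ab(2)], of z] xz by simp
    then have "b [^] z \<otimes> b = b [^] Suc (p - 1)" by simp
    then show ?thesis using ex[OF ab(2)] p by simp
  qed
  ultimately have "b = m"
    using m ab by (metis inv_equality inv_inv l_one nat_pow_closed m_comm)
  moreover have "shift G a b S T b = b" using ST by (auto simp: shift_def)
  ultimately show False using m ab by blast
qed

text \<open>Only \<open>b\<close> is moved onto \<open>a \<otimes> b\<close> by \<open>a\<close>,
  and only \<open>a\<close> by \<open>b\<close>; neither lies in \<open>S\<close> or
  \<open>T\<close>. So if \<open>a \<otimes> b\<close> is hit, it is a label of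
  \<open>Y\<close>.\<close>

lemma shift_hits_product:
  assumes r: "rooted_shift G a b S T" and v: "v \<in> carrier G - {\<one>}"
    and hit: "shift G a b S T v = a \<otimes> b"
  shows "v = a \<otimes> b" "v \<notin> S" "v \<notin> T"
proof -
  have ab: "a \<in> carrier G" "b \<in> carrier G" "a \<noteq> \<one>" "b \<noteq> \<one>" and
    ST: "S \<subseteq> carrier G - {\<one>, a, b}" "T \<subseteq> carrier G - {\<one>, a, b}"
    using r by (auto simp: rooted_shift_def)
  show S: "v \<notin> S"
  proof
    assume "v \<in> S"
    then have "v \<otimes> a = b \<otimes> a" using hit ab by (simp add: shift_def m_comm)
    then have "v = b" using v ab by simp
    then show False using \<open>v \<in> S\<close> ST by auto
  qed
  show T: "v \<notin> T"
  proof
    assume "v \<in> T"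
    then have "v \<otimes> b = a \<otimes> b" using hit S by (simp add: shift_def)
    then have "v = a" using v ab by simp
    then show False using \<open>v \<in> T\<close> ST by auto
  qed
  show "v = a \<otimes> b" using S T hit by (simp add: shift_def)
qed

lemma pow_residue:
  fixes n i p :: nat
  assumes x: "x \<in> carrier G" "x [^] p = \<one>" and n: "n mod p = p - i" "i \<le> p" "0 < i"
  shows "x [^] n \<otimes> x [^] i = \<one>"
proof -
  have "x [^] n = x [^] (p - i)" using pow_mod_exponent[OF x, of n] n by simp
  then have "x [^] n \<otimes> x [^] i = x [^] (p - i + i)" using x by (simp only: nat_pow_mult)
  then show ?thesis using n x by simp
qed

lemma missing_eq:
  assumes "a \<in> carrier G" "b \<in> carrier G" "m \<in> carrier G"
    and "m \<otimes> (a [^] (x::nat) \<otimes> b [^] (z::nat)) = \<one>"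
    and "a [^] x \<otimes> a [^] (i::nat) = \<one>" "b [^] z \<otimes> b [^] (j::nat) = \<one>"
  shows "m = a [^] i \<otimes> b [^] j"
proof -
  have "m = m \<otimes> (a [^] x \<otimes> a [^] i) \<otimes> (b [^] z \<otimes> b [^] j)" using assms by simp
  also have "\<dots> = m \<otimes> (a [^] x \<otimes> b [^] z) \<otimes> (a [^] i \<otimes> b [^] j)"
    using assms(1-3) by (simp add: m_ac)
  finally show ?thesis using assms by simp
qed

lemma rooted_shift_complement:
  assumes fin: "finite (carrier G)" and r: "rooted_shift G a b S T"
  shows "card (carrier G) = card S + card T + card (carrier G - ({\<one>, a, b} \<union> S \<union> T)) + 3"
proof -
  have ab: "a \<in> carrier G" "a \<noteq> \<one>" "b \<in> carrier G" "b \<noteq> \<one>" "a \<noteq> b"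
    and ST: "S \<subseteq> carrier G - {\<one>, a, b}" "T \<subseteq> carrier G - {\<one>, a, b}" "S \<inter> T = {}"
    using r by (auto simp: rooted_shift_def)
  have f: "finite S" "finite T" using ST fin by (auto intro: finite_subset)
  have "card ({\<one>, a, b} \<union> S \<union> T) = 3 + card S + card T"
  proof -
    have "card ({\<one>, a, b} \<union> S \<union> T) = card ({\<one>, a, b} \<union> S) + card T"
      using f ST by (intro card_Un_disjoint) auto
    also have "card ({\<one>, a, b} \<union> S) = card {\<one>, a, b} + card S"
      using f ST by (intro card_Un_disjoint) auto
    finally show ?thesis using ab by simp
  qed
  moreover have "card ({\<one>, a, b} \<union> S \<union> T) + card (carrier G - ({\<one>, a, b} \<union> S \<union> T)) = card (carrier G)"
    using ST ab fin by (subst card_Un_disjoint[symmetric]) (auto intro!: arg_cong[where f = card] f)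
  ultimately show ?thesis by simp
qed

text \<open>The missed element is \<open>a \<otimes> b \<otimes> b\<close>, so
  \<open>a \<otimes> b\<close> is hit and must be a label of \<open>Y\<close>, while the cardinality
  leaves no label for \<open>Y\<close>.\<close>

lemma not_rooted_no_fixed:
  assumes fin: "finite (carrier G)" and ex: "\<And>x. x \<in> carrier G \<Longrightarrow> x [^] p = \<one>"
    and xz: "x mod p = p - 1" "z mod p = p - 2" and p: "p \<ge> 2"
    and card: "card (carrier G) = x + z + 3"
  shows "\<not> rooted G x z"
proof
  assume "rooted G x z"
  then obtain a b S T where r: "rooted_shift G a b S T" and c: "card S = x" "card T = z"
    unfolding rooted_def by blast
  have ab: "a \<in> carrier G" "b \<in> carrier G" "a \<noteq> \<one>" "b \<noteq> \<one>" "a \<noteq> b" and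
    ST: "S \<subseteq> carrier G - {\<one>, a, b}" "T \<subseteq> carrier G - {\<one>, a, b}" "S \<inter> T = {}"
    and inj: "inj_on (shift G a b S T) (carrier G - {\<one>})"
    using r by (auto simp: rooted_shift_def)
  obtain m where m: "m \<in> carrier G" "shift G a b S T ` (carrier G - {\<one>}) = carrier G - {m}"
    "m \<otimes> (a [^] x \<otimes> b [^] z) = \<one>"
    using shift_image_subgroup[OF subgroup_self fin ab(1,2) ST inj] c by metis
  have "m = a [^] (1::nat) \<otimes> b [^] (2::nat)"
    by (rule missing_eq[OF ab(1,2) m(1,3)])
      (rule pow_residue[where p = p]; use ab ex xz p in simp)+
  then have "m = (a \<otimes> b) \<otimes> b" using ab by (simp add: numeral_2_eq_2 m_assoc)
  then have "m \<noteq> a \<otimes> b" using ab r_cancel_one'[of b "a \<otimes> b"] by auto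
  then obtain v where v: "v \<in> carrier G - {\<one>}" "shift G a b S T v = a \<otimes> b"
    using m(2) ab by (metis Diff_iff imageE m_closed singletonD)
  have "carrier G - ({\<one>, a, b} \<union> S \<union> T) = {}"
    using rooted_shift_complement[OF fin r] c card fin by simp
  moreover have "v \<in> carrier G - ({\<one>, a, b} \<union> S \<union> T)"
    using shift_hits_product[OF r v] v ab by auto
  ultimately show False by blast
qed

text \<open>The missed element is \<open>a\<close> times the cube of \<open>b\<close>, so
  \<open>a \<otimes> b\<close> is hit and is the only label of \<open>Y\<close>. Let
  \<open>D\<close> be generated by \<open>d = a \<otimes> inv b\<close>, so that both translations
  send the coset of \<open>b\<close> to the coset of \<open>b \<otimes> b\<close>. If
  \<open>b\<close> lies in \<open>D\<close>, counting inside \<open>D\<close> gives a power of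
  \<open>d\<close> equal to \<open>\<one>\<close> with an exponent between \<open>1\<close> and
  \<open>p - 1\<close>. Otherwise the \<open>p - 1\<close> elements of the coset of
  \<open>b \<otimes> b\<close> other than \<open>a \<otimes> b\<close> are all hit from the coset of
  \<open>b\<close>, which has only \<open>p - 2\<close> elements besides \<open>a\<close> and
  \<open>b\<close>.\<close>

lemma not_rooted_one_fixed:
  assumes fin: "finite (carrier G)" and ex: "\<And>x. x \<in> carrier G \<Longrightarrow> x [^] p = \<one>"
    and p: "prime p" "p \<ge> 5"
    and xz: "x mod p = p - 1" "z mod p = p - 3"
    and card: "card (carrier G) = x + z + 4"
  shows "\<not> rooted G x z"
proof
  assume "rooted G x z"
  then obtain a b S T where r: "rooted_shift G a b S T" and c: "card S = x" "card T = z"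
    unfolding rooted_def by blast
  have ab: "a \<in> carrier G" "b \<in> carrier G" "a \<noteq> \<one>" "b \<noteq> \<one>" "a \<noteq> b" and
    ST: "S \<subseteq> carrier G - {\<one>, a, b}" "T \<subseteq> carrier G - {\<one>, a, b}" "S \<inter> T = {}"
    and inj: "inj_on (shift G a b S T) (carrier G - {\<one>})"
    using r by (auto simp: rooted_shift_def)
  have ord: "ord y = p" if "y \<in> carrier G" "y \<noteq> \<one>" for y
  proof -
    have "ord y dvd p" using pow_eq_id[OF that(1)] ex[OF that(1)] by simp
    then show ?thesis using p ord_eq_1[OF that(1)] that by (auto simp: prime_nat_iff)
  qed
  obtain m where m: "m \<in> carrier G" "shift G a b S T ` (carrier G - {\<one>}) = carrier G - {m}"
    "m \<otimes> (a [^] x \<otimes> b [^] z) = \<one>"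
    using shift_image_subgroup[OF subgroup_self fin ab(1,2) ST inj] c by metis
  have "m = a [^] (1::nat) \<otimes> b [^] (3::nat)"
    by (rule missing_eq[OF ab(1,2) m(1,3)])
      (rule pow_residue[where p = p]; use ab ex xz p in simp)+
  then have m_eq: "m = (a \<otimes> b) \<otimes> (b \<otimes> b)" using ab by (simp add: numeral_3_eq_3 m_assoc)
  have "b \<otimes> b \<noteq> \<one>"
  proof
    assume "b \<otimes> b = \<one>"
    then have "b [^] (2::nat) = \<one>" using ab by (simp add: numeral_2_eq_2)
    then have "p dvd 2" using pow_eq_id[OF ab(2)] ord[OF ab(2,4)] by simp
    then show False using p by (auto dest: dvd_imp_le)
  qed
  then have "m \<noteq> a \<otimes> b" using ab r_cancel_one'[of "b \<otimes> b" "a \<otimes> b"] by (auto simp: m_eq)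
  then obtain v where v: "v \<in> carrier G - {\<one>}" "shift G a b S T v = a \<otimes> b"
    using m(2) ab by (metis Diff_iff imageE m_closed singletonD)
  define Y where "Y = carrier G - ({\<one>, a, b} \<union> S \<union> T)"
  have "card Y = 1" using rooted_shift_complement[OF fin r] c card by (simp add: Y_def)
  moreover have abY: "a \<otimes> b \<in> Y"
    using shift_hits_product[OF r v] v ab by (auto simp: Y_def)
  ultimately have Y: "Y = {a \<otimes> b}" by (auto simp: card_1_singleton_iff)
  have part: "u \<in> {\<one>, a, b, a \<otimes> b} \<union> S \<union> T" if "u \<in> carrier G" for u
    using that Y by (auto simp: Y_def)
  have ab1: "a \<otimes> b \<noteq> \<one>" "a \<otimes> b \<noteq> a" "a \<otimes> b \<noteq> b" "a \<otimes> b \<notin> S" "a \<otimes> b \<notin> T"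
    using abY by (auto simp: Y_def)
  define d where "d = a \<otimes> inv b"
  define D where "D = generate G {d}"
  have d: "d \<in> carrier G" "d \<noteq> \<one>"
    using ab inv_equality[of "inv b" a] by (auto simp: d_def) (metis inv_closed inv_equality inv_inv)
  have a_d: "a = d \<otimes> b" using ab by (simp add: d_def m_assoc)
  have DG: "subgroup D G" unfolding D_def using d by (intro generate_is_subgroup) auto
  then have Dsub: "D \<subseteq> carrier G" by (simp add: subgroup_def)
  have dD: "d \<in> D" unfolding D_def by (auto intro: generate.incl)
  have Dc: "card D = p" unfolding D_def using generate_pow_card[OF d(1)] ord[OF d] by simp
  have finD: "finite D" using Dsub fin by (auto intro: finite_subset)
  show False
  proof (cases "b \<in> D")
    case True
    then have aD: "a \<in> D" using a_d subgroup.m_closed[OF DG dD] by auto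
    have STD: "S \<inter> D \<subseteq> D - {\<one>, a, b}" "T \<inter> D \<subseteq> D - {\<one>, a, b}" "S \<inter> D \<inter> (T \<inter> D) = {}"
      using ST by auto
    have sh: "shift G a b (S \<inter> D) (T \<inter> D) u = shift G a b S T u" if "u \<in> D" for u
      using that by (auto simp: shift_def)
    have "inj_on (shift G a b (S \<inter> D) (T \<inter> D)) (D - {\<one>})"
      using inj_on_subset[OF inj, of "D - {\<one>}"] Dsub sh by (auto simp: inj_on_def)
    then obtain m' where m': "m' \<in> D" "shift G a b (S \<inter> D) (T \<inter> D) ` (D - {\<one>}) = D - {m'}"
      "m' \<otimes> (a [^] card (S \<inter> D) \<otimes> b [^] card (T \<inter> D)) = \<one>"
      using shift_image_subgroup[OF DG finD aD True STD] by metis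
    \<comment> \<open>Since \<open>m\<close> lies in \<open>D\<close>, it is also the element missed
      by the restriction to \<open>D\<close>, whose equation involves only the counts inside
      \<open>D\<close>.\<close>
    have "m \<notin> shift G a b (S \<inter> D) (T \<inter> D) ` (D - {\<one>})"
      using m(2) Dsub sh by auto
    moreover have "m \<in> D" unfolding m_eq using aD True subgroup.m_closed[OF DG] by auto
    ultimately have "m = m'" using m'(2) by auto
    define i where "i = card (S \<inter> D)"
    define j where "j = card (T \<inter> D)"
    have "D = {\<one>, a, b, a \<otimes> b} \<union> (S \<inter> D) \<union> (T \<inter> D)"
      using part Dsub aD True subgroup.m_closed[OF DG aD True] subgroup.one_closed[OF DG] by auto
    moreover have "card ({\<one>, a, b, a \<otimes> b} \<union> (S \<inter> D) \<union> (T \<inter> D)) = 4 + i + j"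
    proof -
      have "card ({\<one>, a, b, a \<otimes> b} \<union> (S \<inter> D) \<union> (T \<inter> D)) =
          card ({\<one>, a, b, a \<otimes> b} \<union> (S \<inter> D)) + card (T \<inter> D)"
        using ab1 ST finD by (intro card_Un_disjoint) auto
      also have "card ({\<one>, a, b, a \<otimes> b} \<union> (S \<inter> D)) = card {\<one>, a, b, a \<otimes> b} + card (S \<inter> D)"
        using ab1 ST finD by (intro card_Un_disjoint) auto
      also have "card {\<one>, a, b, a \<otimes> b} = 4" using ab ab1 by (auto simp: card_insert_if)
      finally show ?thesis by (simp add: i_def j_def)
    qed
    ultimately have ij: "4 + i + j = p" using Dc by simp
    have bp: "b [^] (i + 1 + j + 3) = \<one>" using ex[OF ab(2)] ij by (simp add: ac_simps)
    \<comment> \<open>Inserting \<open>m\<close> turns the exponents into \<open>i + 1\<close> and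
      \<open>j + 3\<close>. After substituting \<open>a = d \<otimes> b\<close> the total exponent
      of \<open>b\<close> is \<open>i + j + 4 = p\<close>, so only the power of \<open>d\<close>
      survives.\<close>
    have "\<one> = a [^] (i + 1) \<otimes> b [^] (j + 3)"
      using m'(3) ab unfolding \<open>m = m'\<close>[symmetric] m_eq i_def[symmetric] j_def[symmetric]
      by (simp add: numeral_3_eq_3 m_ac)
    also have "\<dots> = d [^] (i + 1) \<otimes> (b [^] (i + 1) \<otimes> b [^] (j + 3))"
      unfolding a_d using ab d by (simp only: nat_pow_distrib nat_pow_closed m_assoc)
    also have "\<dots> = d [^] (i + 1) \<otimes> \<one>"
      using bp ab by (simp only: nat_pow_mult add.assoc)
    also have "\<dots> = d [^] (i + 1)" using d by (intro r_one nat_pow_closed)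
    finally have "d [^] (i + 1) = \<one>" by (rule sym)
    then have "p dvd i + 1" using pow_eq_id[OF d(1), of "i + 1"] unfolding ord[OF d] by blast
    then show False using ij by (auto dest: dvd_imp_le)
  next
    case False
    define C1 where "C1 = (\<lambda>u. u \<otimes> b) ` D"
    define C2 where "C2 = (\<lambda>u. u \<otimes> (b \<otimes> b)) ` D"
    have C: "card C1 = p" "card C2 = p"
      unfolding C1_def C2_def Dc[symmetric] using Dsub ab
      by (auto intro!: card_image inj_onI simp: subset_iff)
    have finC: "finite C1" "finite C2" using finD by (auto simp: C1_def C2_def)
    have C1: "u \<in> C1 \<longleftrightarrow> u \<otimes> inv b \<in> D" if "u \<in> carrier G" for u
    proof
      assume "u \<in> C1"
      then show "u \<otimes> inv b \<in> D" using ab Dsub by (auto simp: C1_def m_assoc subset_iff)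
    next
      assume "u \<otimes> inv b \<in> D"
      then show "u \<in> C1" unfolding C1_def using that ab by (intro image_eqI) (auto simp: m_assoc)
    qed
    have abC1: "a \<in> C1" "b \<in> C1"
      using C1 ab dD subgroup.one_closed[OF DG] by (auto simp: d_def)
    have "C2 - {a \<otimes> b} \<subseteq> shift G a b S T ` (C1 - {a, b})"
    proof
      fix t assume t: "t \<in> C2 - {a \<otimes> b}"
      then obtain u where u: "u \<in> D" "t = u \<otimes> (b \<otimes> b)" by (auto simp: C2_def)
      have uG: "u \<in> carrier G" using u Dsub by auto
      have tG: "t \<in> carrier G" using u uG ab by simp
      have off: "w \<notin> D" if "w \<in> D \<longleftrightarrow> b \<in> D" for w using that False by simp
      have subD: "w \<otimes> y \<in> D \<longleftrightarrow> y \<in> D" if "w \<in> D" "y \<in> carrier G" for w y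
      proof
        assume "w \<otimes> y \<in> D"
        then have "inv w \<otimes> (w \<otimes> y) \<in> D"
          using subgroup.m_closed[OF DG] subgroup.m_inv_closed[OF DG] that by blast
        then show "y \<in> D" using that Dsub by (simp add: m_assoc[symmetric] subset_iff)
      next
        assume "y \<in> D" then show "w \<otimes> y \<in> D" using subgroup.m_closed[OF DG] that by blast
      qed
      have tm: "t \<noteq> m"
      proof
        assume "t = m"
        then have "u \<otimes> (b \<otimes> b) = (d \<otimes> (b \<otimes> b)) \<otimes> (b \<otimes> b)"
          using u ab d by (simp add: m_eq a_d m_ac)
        then have "u = d \<otimes> (b \<otimes> b)" using uG d ab by simp
        then have bb: "b \<otimes> b \<in> D" using u subD[OF dD] ab by auto
        \<comment> \<open>As \<open>p\<close> is odd, \<open>b\<close> is a power of its own square,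
          so \<open>b\<close> would lie in \<open>D\<close> as well.\<close>
        have "even (p + 1)" using p prime_odd_nat[of p] by simp
        then obtain h where h: "p + 1 = 2 * h" by blast
        have "b = b [^] (p + 1)" using ex[OF ab(2)] ab by simp
        also have "\<dots> = (b [^] (2::nat)) [^] h" unfolding h using ab by (simp only: nat_pow_pow)
        also have "b [^] (2::nat) = b \<otimes> b" using ab by (simp add: numeral_2_eq_2)
        also have "(b \<otimes> b) [^] h \<in> D"
          using bb DG by (induction h) (auto simp: subgroup.one_closed subgroup.m_closed)
        finally show False using False by simp
      qed
      then obtain v where v: "v \<in> carrier G - {\<one>}" "shift G a b S T v = t"
        using m(2) tG by (metis Diff_iff imageE singletonD)
      have not_fixed: "v \<in> S \<or> v \<in> T"
      proof (rule ccontr)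
        assume n: "\<not> (v \<in> S \<or> v \<in> T)"
        then have "v = t" using v by (simp add: shift_def)
        then have "t = a \<or> t = b" using part[OF tG] n v t by auto
        then have "t \<in> C1" using abC1 by auto
        then have "u \<otimes> b \<in> D" using C1[OF tG] u uG ab by (simp add: m_assoc)
        then show False using subD[OF u(1)] ab False by auto
      qed
      have "v \<in> C1"
      proof (cases "v \<in> S")
        case True
        then have "d \<otimes> v = u \<otimes> b"
          using v u ab uG d by (simp add: shift_def a_d m_ac)
        then have "d \<otimes> (v \<otimes> inv b) = u \<otimes> b \<otimes> inv b"
          using v ab d by (simp add: m_assoc[symmetric])
        also have "\<dots> = u" using ab uG by (simp add: m_assoc)
        finally have "d \<otimes> (v \<otimes> inv b) = u" .
        then show ?thesis using C1[of v] subD[OF dD, of "v \<otimes> inv b"] u v ab by auto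
      next
        case False
        then have "v \<otimes> b = u \<otimes> b \<otimes> b"
          using v u ab uG not_fixed by (simp add: shift_def m_assoc)
        then have "v = u \<otimes> b" using v ab uG by simp
        then show ?thesis using u by (auto simp: C1_def)
      qed
      moreover have "v \<noteq> a" "v \<noteq> b" using not_fixed ST by auto
      ultimately show "t \<in> shift G a b S T ` (C1 - {a, b})" using v(2) by auto
    qed
    then have "card (C2 - {a \<otimes> b}) \<le> card (C1 - {a, b})"
      using finC by (intro surj_card_le) auto
    moreover have "card (C1 - {a, b}) = p - 2"
      using C abC1 ab finC by (simp add: card_Diff_subset)
    moreover have "card (C2 - {a \<otimes> b}) \<ge> p - 1"
      using C finC by (simp add: card_Diff_singleton_if)
    ultimately show False using p by simp
  qed
qed

end

section \<open>Blocks: shifts of one coset\<close>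

definition rshift :: "int \<Rightarrow> int \<Rightarrow> int \<Rightarrow> int set \<Rightarrow> int set \<Rightarrow> int \<Rightarrow> int" where
  "rshift p a b S T v =
    (if v \<in> S then (v + a) mod p else if v \<in> T then (v + b) mod p else v)"

definition block :: "int \<Rightarrow> int \<Rightarrow> int \<Rightarrow> nat \<Rightarrow> nat \<Rightarrow> bool" where
  "block p a b x z \<longleftrightarrow> (\<exists>S T. S \<subseteq> {0..<p} \<and> T \<subseteq> {0..<p} \<and> S \<inter> T = {} \<and>
     card S = x \<and> card T = z \<and> inj_on (rshift p a b S T) {0..<p})"

text \<open>This describes the subgroup containing \<open>a\<close> and \<open>b\<close>: position
  \<open>0\<close> is taken by \<open>s2\<close>, positions \<open>a\<close> and \<open>b\<close> by
  \<open>s1\<close> and \<open>s3\<close>. In any other coset, described by \<open>block\<close>, no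
  position is reserved.\<close>

definition base_block :: "int \<Rightarrow> int \<Rightarrow> int \<Rightarrow> nat \<Rightarrow> nat \<Rightarrow> bool" where
  "base_block p a b x z \<longleftrightarrow> 0 < a \<and> a < p \<and> 0 < b \<and> b < p \<and> a \<noteq> b \<and>
     (\<exists>S T. S \<subseteq> {0..<p} - {0, a, b} \<and> T \<subseteq> {0..<p} - {0, a, b} \<and> S \<inter> T = {} \<and>
     card S = x \<and> card T = z \<and> inj_on (rshift p a b S T) ({0..<p} - {0}))"

lemma inj_on_mod_interval: "inj_on (\<lambda>v::int. v mod p) {c..<c + p}"
proof (rule inj_onI)
  fix u v assume uv: "u \<in> {c..<c + p}" "v \<in> {c..<c + p}" "u mod p = v mod p"
  then have "p dvd u - v" by (simp add: mod_eq_dvd_iff)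
  moreover have "\<bar>u - v\<bar> < p" using uv by auto
  ultimately show "u = v" using zdvd_not_zless[of "\<bar>u - v\<bar>" p] by auto
qed

text \<open>The residues may be represented by any interval of \<open>p\<close> consecutive integers, on which the
  shift becomes an honest map \<open>\<psi>\<close> of integers.\<close>

lemma inj_on_rshift_mod:
  assumes p: "p > 0" and C: "C \<subseteq> {c..<c + p}" and ST: "S \<subseteq> C" "T \<subseteq> C" "S \<inter> T = {}"
    and \<psi>: "\<psi> ` C \<subseteq> {d..<d + p}" "inj_on \<psi> C"
      "\<And>v. v \<in> S \<Longrightarrow> [\<psi> v = v + a] (mod p)" "\<And>v. v \<in> T \<Longrightarrow> [\<psi> v = v + b] (mod p)"
      "\<And>v. v \<in> C - S - T \<Longrightarrow> [\<psi> v = v] (mod p)"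
  shows "inj_on (rshift p a b ((\<lambda>v. v mod p) ` S) ((\<lambda>v. v mod p) ` T)) ((\<lambda>v. v mod p) ` C)"
proof -
  let ?r = "\<lambda>v. v mod p"
  have mem: "v mod p \<in> ?r ` W \<longleftrightarrow> v \<in> W" if "v \<in> C" "W \<subseteq> C" for v W
  proof
    assume "v mod p \<in> ?r ` W"
    then obtain w where "w \<in> W" "v mod p = w mod p" by auto
    then show "v \<in> W" using inj_on_mod_interval[of p c] C that unfolding inj_on_def by blast
  qed auto
  have "rshift p a b (?r ` S) (?r ` T) (v mod p) = \<psi> v mod p" if v: "v \<in> C" for v
    unfolding rshift_def mem[OF v ST(1)] mem[OF v ST(2)]
    using \<psi>(3-5)[of v] v by (auto simp: cong_def mod_add_left_eq)
  moreover have "inj_on (\<lambda>v. \<psi> v mod p) C"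
    using comp_inj_on[OF \<psi>(2) inj_on_subset[OF inj_on_mod_interval \<psi>(1)]] by (simp add: o_def)
  ultimately have "inj_on (rshift p a b (?r ` S) (?r ` T) \<circ> ?r) C"
    by (subst inj_on_cong[where g = "\<lambda>v. \<psi> v mod p"]) auto
  then show ?thesis by (rule inj_on_imageI)
qed

text \<open>The window \<open>{c..<c + p}\<close> can be placed around \<open>0\<close>, so that
  intervals on both sides of \<open>0\<close> need not wrap; \<open>a'\<close> and \<open>b'\<close>
  represent \<open>a\<close> and \<open>b\<close> in it.\<close>

lemma base_blockI:
  assumes p: "p > 0" and C: "c \<le> 0" "0 < c + p"
    and ab: "0 < a" "a < p" "0 < b" "b < p" "a \<noteq> b"
    and ab': "a' \<in> {c..<c + p}" "[a' = a] (mod p)" "b' \<in> {c..<c + p}" "[b' = b] (mod p)"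
    and ST: "S \<subseteq> {c..<c + p} - {0, a', b'}" "T \<subseteq> {c..<c + p} - {0, a', b'}" "S \<inter> T = {}"
    and \<psi>: "\<psi> ` ({c..<c + p} - {0}) \<subseteq> {d..<d + p}" "inj_on \<psi> ({c..<c + p} - {0})"
      "\<And>v. v \<in> S \<Longrightarrow> [\<psi> v = v + a] (mod p)" "\<And>v. v \<in> T \<Longrightarrow> [\<psi> v = v + b] (mod p)"
      "\<And>v. v \<in> {c..<c + p} - {0} - S - T \<Longrightarrow> [\<psi> v = v] (mod p)"
    and card: "card S = x" "card T = z"
  shows "base_block p a b x z"
proof -
  let ?r = "\<lambda>v. v mod p"
  have inj: "inj_on ?r {c..<c + p}" by (rule inj_on_mod_interval)
  have surj: "?r ` {c..<c + p} = {0..<p}"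
  proof (intro equalityI subsetI)
    fix v assume v: "v \<in> {0..<p}"
    have "(c + (v - c) mod p) mod p = v" using v by (simp add: mod_add_right_eq)
    then show "v \<in> ?r ` {c..<c + p}" using p by (intro image_eqI[of _ _ "c + (v - c) mod p"]) auto
  qed (use p in auto)
  have r: "?r a' = a" "?r b' = b" "?r 0 = 0" using ab ab' by (simp_all add: cong_def)
  have diff: "?r ` ({c..<c + p} - W) = {0..<p} - ?r ` W" if "W \<subseteq> {c..<c + p}" for W
    using inj_on_image_set_diff[OF inj _ that] surj by simp
  have "?r ` ({c..<c + p} - {0}) = {0..<p} - {0}" using diff[of "{0}"] C by simp
  then have "inj_on (rshift p a b (?r ` S) (?r ` T)) ({0..<p} - {0})"
    using inj_on_rshift_mod[of p "{c..<c + p} - {0}" c S T \<psi> d a b] p ST \<psi> by auto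
  moreover have "?r ` ({c..<c + p} - {0, a', b'}) = {0..<p} - {0, a, b}"
    using diff[of "{0, a', b'}"] C ab' r by simp
  then have "?r ` S \<subseteq> {0..<p} - {0, a, b}" "?r ` T \<subseteq> {0..<p} - {0, a, b}"
    using ST by (metis image_mono)+
  moreover have "?r ` S \<inter> ?r ` T = {}"
    using inj_on_image_Int[OF inj, of S T] ST by auto
  moreover have "card (?r ` S) = x" "card (?r ` T) = z"
    using card ST by (auto intro!: card_image[THEN trans] inj_on_subset[OF inj])
  ultimately show ?thesis unfolding base_block_def using ab by blast
qed

lemma base_block_trivial:
  "0 < a \<Longrightarrow> a < p \<Longrightarrow> 0 < b \<Longrightarrow> b < p \<Longrightarrow> a \<noteq> b \<Longrightarrow> base_block p a b 0 0"
  unfolding base_block_def by (auto simp: inj_on_def rshift_def intro!: exI[of _ "{}"])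

lemma block_cong:
  assumes "[a = a'] (mod p)" "[b = b'] (mod p)" and "block p a b x z"
  shows "block p a' b' x z"
proof -
  have "rshift p a b = rshift p a' b'"
    using cong_add[OF cong_refl assms(1)] cong_add[OF cong_refl assms(2)]
    unfolding rshift_def cong_def by (intro ext) simp
  then show ?thesis using assms(3) by (simp add: block_def)
qed

text \<open>Multiplication by a unit permutes the residues and turns translation by \<open>a\<close>
  into translation by \<open>l * a\<close>.\<close>

lemma block_scale:
  assumes p: "p > 0" and l: "coprime l p" and b: "block p a b x z"
  shows "block p (l * a) (l * b) x z"
proof -
  obtain S T where ST: "S \<subseteq> {0..<p}" "T \<subseteq> {0..<p}" "S \<inter> T = {}" "card S = x" "card T = z"
    and inj: "inj_on (rshift p a b S T) {0..<p}"
    using b unfolding block_def by blast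
  let ?r = "\<lambda>v. (l * v) mod p"
  have injr: "inj_on ?r {0..<p}"
  proof (rule inj_onI)
    fix u v assume uv: "u \<in> {0..<p}" "v \<in> {0..<p}" "?r u = ?r v"
    then have "[u = v] (mod p)" using l by (simp add: cong_def[symmetric] cong_mult_lcancel)
    then show "u = v" using uv by (simp add: cong_def)
  qed
  have im: "?r ` {0..<p} = {0..<p}"
    using injr p by (intro card_subset_eq) (auto simp: card_image)
  have mem: "?r v \<in> ?r ` W \<longleftrightarrow> v \<in> W" if "v \<in> {0..<p}" "W \<subseteq> {0..<p}" for v W
    using injr that unfolding inj_on_def by blast
  have "rshift p (l * a) (l * b) (?r ` S) (?r ` T) (?r v) = ?r (rshift p a b S T v)"
    if v: "v \<in> {0..<p}" for v
    unfolding rshift_def mem[OF v ST(1)] mem[OF v ST(2)]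
    by (simp add: mod_add_left_eq mod_mult_right_eq distrib_left)
  moreover have "rshift p a b S T ` {0..<p} \<subseteq> {0..<p}"
    using p by (auto simp: rshift_def)
  then have "inj_on (?r \<circ> rshift p a b S T) {0..<p}"
    using inj injr by (intro comp_inj_on) (auto intro: inj_on_subset)
  ultimately have "inj_on (rshift p (l * a) (l * b) (?r ` S) (?r ` T) \<circ> ?r) {0..<p}"
    by (subst inj_on_cong[where g = "?r \<circ> rshift p a b S T"]) auto
  then have "inj_on (rshift p (l * a) (l * b) (?r ` S) (?r ` T)) {0..<p}"
    using inj_on_imageI[of _ ?r "{0..<p}"] im by metis
  moreover have "?r ` S \<subseteq> {0..<p}" "?r ` T \<subseteq> {0..<p}" using p by auto
  moreover have "?r ` S \<inter> ?r ` T = {}"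
    using inj_on_image_Int[OF injr, of S T] ST by auto
  moreover have "card (?r ` S) = x" "card (?r ` T) = z"
    using ST by (auto intro!: card_image[THEN trans] inj_on_subset[OF injr])
  ultimately show ?thesis unfolding block_def by blast
qed

text \<open>Two adjacent intervals of lengths \<open>z\<close> and \<open>x\<close> change places:
  the lower one moves up by \<open>x\<close>, the upper one down by \<open>z\<close>.\<close>

lemma block_swap:
  assumes "int x + int z \<le> p"
  shows "block p (- int z) (int x) x z"
proof -
  let ?S = "{int z..<int z + int x}" and ?T = "{0..<int z}"
  have e: "rshift p (- int z) (int x) ?S ?T v =
      (if v \<in> ?S then v - int z else if v \<in> ?T then v + int x else v)" for v
    using assms by (auto simp: rshift_def)
  have "inj_on (rshift p (- int z) (int x) ?S ?T) {0..<p}"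
    unfolding e inj_on_def by auto
  then show ?thesis unfolding block_def using assms
    by (intro exI[of _ ?S] exI[of _ ?T]) auto
qed

lemma block_full:
  assumes "p > 0"
  shows "block p a b (nat p) 0" "block p a b 0 (nat p)" "block p a b 0 0"
proof -
  have i: "inj_on (\<lambda>v. (v + c) mod p) {0..<p}" for c
  proof (rule inj_onI)
    fix u v assume uv: "u \<in> {0..<p}" "v \<in> {0..<p}" "(u + c) mod p = (v + c) mod p"
    then have "[u = v] (mod p)" by (simp add: cong_def[symmetric] cong_add_rcancel)
    then show "u = v" using uv by (simp add: cong_def)
  qed
  have "inj_on (rshift p a b {0..<p} {}) {0..<p}"
    by (rule inj_on_cong[THEN iffD2, OF _ i[of a]]) (simp add: rshift_def)
  then show "block p a b (nat p) 0" unfolding block_def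
    by (intro exI[of _ "{0..<p}"] exI[of _ "{}"]) auto
  have "inj_on (rshift p a b {} {0..<p}) {0..<p}"
    by (rule inj_on_cong[THEN iffD2, OF _ i[of b]]) (simp add: rshift_def)
  then show "block p a b 0 (nat p)" unfolding block_def
    by (intro exI[of _ "{0..<p}"] exI[of _ "{}"]) auto
  show "block p a b 0 0" unfolding block_def
    by (intro exI[of _ "{}"]) (auto simp: rshift_def inj_on_def)
qed

text \<open>Up to scaling this is \<open>block_swap\<close>: if \<open>l * x\<close> is congruent to
  \<open>b\<close>, then the vanishing sum makes \<open>l * - z\<close> congruent to
  \<open>a\<close>. Scaling needs \<open>x\<close> to be invertible, so a zero count is treated
  apart; the other count is then \<open>0\<close> or \<open>p\<close>.\<close>

lemma block_zero_sum:
  assumes p: "prime p" and ab: "\<not> p dvd a" "\<not> p dvd b"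
    and le: "int x + int z \<le> p" and sum: "p dvd int x * a + int z * b"
  shows "block p a b x z"
proof -
  have p0: "p > 0" using p by (simp add: prime_gt_0_int)
  consider "x = 0" | "z = 0" | "x > 0" "z > 0" by auto
  then show ?thesis
  proof cases
    case 1
    then have "p dvd int z" using sum ab p by (simp add: prime_dvd_mult_iff)
    then have "z = 0 \<or> int z = p" using le by (auto dest!: zdvd_imp_le)
    then show ?thesis using 1 block_full[OF p0, of a b] by auto
  next
    case 2
    then have "p dvd int x" using sum ab p by (simp add: prime_dvd_mult_iff)
    then have "x = 0 \<or> int x = p" using le by (auto dest!: zdvd_imp_le)
    then show ?thesis using 2 block_full[OF p0, of a b] by auto
  next
    case 3
    then have x: "\<not> p dvd int x" using le by (auto dest!: zdvd_imp_le)
    then have cop: "coprime (int x) p" using p by (metis coprime_commute prime_imp_coprime)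
    then obtain y where y: "[int x * y = 1] (mod p)" by (metis cong_solve_coprime_int)
    define l where "l = b * y"
    have lb: "[l * int x = b] (mod p)"
      using cong_scalar_left[OF y, of b] by (simp add: l_def ac_simps)
    have "[int x * (l * - int z) = int x * a] (mod p)"
    proof -
      have "[int x * (l * - int z) = - (b * int z)] (mod p)"
        using cong_scalar_right[OF lb, of "- int z"] by (simp add: ac_simps)
      also have "[- (b * int z) = int x * a] (mod p)"
      proof -
        have "- (b * int z) - int x * a = - (int x * a + int z * b)" by (simp add: algebra_simps)
        then show ?thesis using sum by (simp only: cong_iff_dvd_diff dvd_minus_iff)
      qed
      finally show ?thesis .
    qed
    then have la: "[l * - int z = a] (mod p)" using cop by (simp only: cong_mult_lcancel)
    have "\<not> p dvd l"
      using lb ab(2) by (metis cong_dvd_iff dvd_mult2)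
    then have "coprime l p" using p by (metis coprime_commute prime_imp_coprime)
    from block_cong[OF la lb block_scale[OF p0 this block_swap[OF le]]] show ?thesis .
  qed
qed

text \<open>The exchange of \<open>block_swap\<close> with the hole \<open>0\<close> between the two
  intervals, which makes each move one step longer. The labels \<open>a\<close> and \<open>b\<close>
  are represented by \<open>- z - 1\<close> and \<open>x + 1\<close>, the positions just outside the
  intervals.\<close>

lemma base_block_swap:
  assumes p: "p > 0" and le: "int x + int z + 3 \<le> p"
  shows "base_block p (p - int z - 1) (int x + 1) x z"
proof (rule base_blockI[where c = "- int z - 1" and a' = "- int z - 1" and b' = "int x + 1"
      and S = "{1..int x}" and T = "{- int z..-1}" and d = "- int z - 1"
      and \<psi> = "\<lambda>v. if v \<in> {1..int x} then v - int z - 1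
        else if v \<in> {- int z..-1} then v + int x + 1 else v"])
  show "inj_on (\<lambda>v. if v \<in> {1..int x} then v - int z - 1
        else if v \<in> {- int z..-1} then v + int x + 1 else v) ({- int z - 1..<- int z - 1 + p} - {0})"
    unfolding inj_on_def by auto
qed (use assms in \<open>auto simp: cong_iff_dvd_diff\<close>)

section \<open>Assembling the blocks\<close>

text \<open>\<open>h i r\<close> is the element in position \<open>i\<close> of the coset \<open>r\<close> of a subgroup of order \<open>p\<close>, which is
  itself the coset \<open>r0\<close>.\<close>

locale coset_coordinates = comm_group G for G (structure) +
  fixes p :: int and R :: "'r set" and r0 :: 'r and h :: "int \<Rightarrow> 'r \<Rightarrow> 'a"
  assumes p_pos: "p > 0" and fin_R: "finite R" and r0: "r0 \<in> R"
    and bij_h: "bij_betw (\<lambda>(r, i). h i r) (R \<times> {0..<p}) (carrier G)"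
    and h_zero: "h 0 r0 = \<one>"
    and h_mult: "\<And>i c r. i \<in> {0..<p} \<Longrightarrow> c \<in> {0..<p} \<Longrightarrow> r \<in> R \<Longrightarrow>
      h i r \<otimes> h c r0 = h ((i + c) mod p) r"
begin

lemma h_closed [simp]: "i \<in> {0..<p} \<Longrightarrow> r \<in> R \<Longrightarrow> h i r \<in> carrier G"
  using bij_betwE[OF bij_h, THEN bspec, of "(r, i)"] by simp

lemma h_eq_iff: "i \<in> {0..<p} \<Longrightarrow> r \<in> R \<Longrightarrow> j \<in> {0..<p} \<Longrightarrow> s \<in> R \<Longrightarrow>
    h i r = h j s \<longleftrightarrow> i = j \<and> r = s"
  using inj_on_eq_iff[OF bij_betw_imp_inj_on[OF bij_h], of "(r, i)" "(s, j)"] by auto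

lemma h_cases: assumes "v \<in> carrier G" obtains i r where "i \<in> {0..<p}" "r \<in> R" "v = h i r"
proof -
  have "v \<in> (\<lambda>(r, i). h i r) ` (R \<times> {0..<p})" using bij_h assms by (simp add: bij_betw_def)
  then show thesis using that by auto
qed

definition lift :: "('r \<Rightarrow> int set) \<Rightarrow> 'a set" where
  "lift S = (\<lambda>(r, i). h i r) ` (SIGMA r:R. S r)"

lemma mem_lift:
  assumes "i \<in> {0..<p}" "r \<in> R" "\<And>r. r \<in> R \<Longrightarrow> S r \<subseteq> {0..<p}"
  shows "h i r \<in> lift S \<longleftrightarrow> i \<in> S r"
proof
  assume "h i r \<in> lift S"
  then obtain s j where "s \<in> R" "j \<in> S s" "h i r = h j s" by (auto simp: lift_def)
  then show "i \<in> S r" using h_eq_iff[of i r j s] assms by blast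
next
  assume "i \<in> S r"
  then show "h i r \<in> lift S"
    unfolding lift_def using assms(2) by (intro image_eqI[of _ _ "(r, i)"]) auto
qed

lemma card_lift:
  assumes "\<And>r. r \<in> R \<Longrightarrow> S r \<subseteq> {0..<p}"
  shows "card (lift S) = (\<Sum>r\<in>R. card (S r))"
proof -
  have "inj_on (\<lambda>(r, i). h i r) (SIGMA r:R. S r)"
    using bij_h assms by (auto simp: bij_betw_def intro: inj_on_subset)
  then have "card (lift S) = card (SIGMA r:R. S r)" unfolding lift_def by (rule card_image)
  also have "\<dots> = (\<Sum>r\<in>R. card (S r))"
    using fin_R assms by (intro card_SigmaI) (auto intro: finite_subset)
  finally show ?thesis .
qed

lemma lift_subset:
  assumes "\<And>r. r \<in> R \<Longrightarrow> S r \<subseteq> {0..<p}"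
  shows "lift S \<subseteq> carrier G"
proof
  fix v assume "v \<in> lift S"
  then obtain r i where "r \<in> R" "i \<in> S r" "v = h i r" by (auto simp: lift_def)
  then show "v \<in> carrier G" using assms[of r] by auto
qed

text \<open>Both translating elements lie in the subgroup \<open>r0\<close>, so every coset is
  mapped to itself and injectivity can be checked on each coset separately.\<close>

lemma rooted_of_blocks:
  assumes base: "base_block p a b x0 z0"
    and blocks: "\<And>r. r \<in> R - {r0} \<Longrightarrow> block p a b (x r) (z r)"
  shows "rooted G (x0 + (\<Sum>r\<in>R - {r0}. x r)) (z0 + (\<Sum>r\<in>R - {r0}. z r))"
proof -
  have ab: "0 < a" "a < p" "0 < b" "b < p" "a \<noteq> b" using base by (auto simp: base_block_def)
  obtain S0 T0 where ST0: "S0 \<subseteq> {0..<p} - {0, a, b}" "T0 \<subseteq> {0..<p} - {0, a, b}" "S0 \<inter> T0 = {}"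
    "card S0 = x0" "card T0 = z0" "inj_on (rshift p a b S0 T0) ({0..<p} - {0})"
    using base unfolding base_block_def by blast
  have "\<forall>r\<in>R - {r0}. \<exists>S T. S \<subseteq> {0..<p} \<and> T \<subseteq> {0..<p} \<and> S \<inter> T = {} \<and>
     card S = x r \<and> card T = z r \<and> inj_on (rshift p a b S T) {0..<p}"
    using blocks unfolding block_def by blast
  then obtain S1 T1 where ST1: "\<And>r. r \<in> R - {r0} \<Longrightarrow> S1 r \<subseteq> {0..<p} \<and> T1 r \<subseteq> {0..<p} \<and>
     S1 r \<inter> T1 r = {} \<and> card (S1 r) = x r \<and> card (T1 r) = z r \<and>
     inj_on (rshift p a b (S1 r) (T1 r)) {0..<p}"
    by metis
  define S where "S = S1(r0 := S0)"
  define T where "T = T1(r0 := T0)"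
  have ST: "S r \<subseteq> {0..<p}" "T r \<subseteq> {0..<p}" "S r \<inter> T r = {}" if "r \<in> R" for r
    using ST0 ST1[of r] that by (auto simp: S_def T_def)
  have inj: "inj_on (rshift p a b (S r) (T r)) ({0..<p} - (if r = r0 then {0} else {}))"
    if "r \<in> R" for r
    using ST0 ST1[of r] that by (auto simp: S_def T_def)
  have r0': "S r0 = S0" "T r0 = T0" by (auto simp: S_def T_def)
  have sh: "shift G (h a r0) (h b r0) (lift S) (lift T) (h i r) = h (rshift p a b (S r) (T r) i) r"
    if "i \<in> {0..<p}" "r \<in> R" for i r
    using that ab h_mult[of i a r] h_mult[of i b r] ST
    by (auto simp: shift_def rshift_def mem_lift)
  have rc: "rshift p a b (S r) (T r) i \<in> {0..<p}" if "i \<in> {0..<p}" for i r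
    using that p_pos by (auto simp: rshift_def)
  have "inj_on (shift G (h a r0) (h b r0) (lift S) (lift T)) (carrier G - {\<one>})"
  proof (rule inj_onI)
    fix u v assume u: "u \<in> carrier G - {\<one>}" and v: "v \<in> carrier G - {\<one>}"
      and eq: "shift G (h a r0) (h b r0) (lift S) (lift T) u =
        shift G (h a r0) (h b r0) (lift S) (lift T) v"
    obtain i r where i: "i \<in> {0..<p}" "r \<in> R" "u = h i r" using u h_cases by blast
    obtain j s where j: "j \<in> {0..<p}" "s \<in> R" "v = h j s" using v h_cases by blast
    have "rshift p a b (S r) (T r) i = rshift p a b (S s) (T s) j" "r = s"
      using eq i j rc by (auto simp: sh h_eq_iff)
    moreover have "r = r0 \<Longrightarrow> i \<noteq> 0" "s = r0 \<Longrightarrow> j \<noteq> 0" using i j u v h_zero by auto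
    ultimately have "i = j" using inj_onD[OF inj[OF i(2)]] i j by auto
    then show "u = v" using i j \<open>r = s\<close> by simp
  qed
  moreover have "h a r0 \<in> carrier G - {\<one>}" "h b r0 \<in> carrier G - {\<one>}" "h a r0 \<noteq> h b r0"
    using ab r0 p_pos by (auto simp: h_zero[symmetric] h_eq_iff)
  moreover have "lift W \<subseteq> carrier G - {\<one>, h a r0, h b r0}"
    if W: "\<And>r. r \<in> R \<Longrightarrow> W r \<subseteq> {0..<p}" "W r0 \<subseteq> {0..<p} - {0, a, b}" for W
  proof -
    have "h c r0 \<notin> lift W" if "c \<in> {0, a, b}" for c
      using that W ab r0 mem_lift[of c r0 W] by auto
    then show ?thesis using lift_subset[of W] W(1) unfolding h_zero[symmetric] by blast
  qed
  then have "lift S \<subseteq> carrier G - {\<one>, h a r0, h b r0}" "lift T \<subseteq> carrier G - {\<one>, h a r0, h b r0}"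
    using ST ST0 r0' by auto
  moreover have "lift S \<inter> lift T = {}"
  proof -
    have "v \<notin> lift T" if "v \<in> lift S" for v
    proof -
      have "v \<in> carrier G" using that lift_subset[of S] ST by blast
      then obtain i r where "i \<in> {0..<p}" "r \<in> R" "v = h i r" by (rule h_cases)
      then show ?thesis using that ST(3)[of r] mem_lift[of i r S] mem_lift[of i r T] ST(1,2) by blast
    qed
    then show ?thesis by auto
  qed
  ultimately have "rooted_shift G (h a r0) (h b r0) (lift S) (lift T)"
    unfolding rooted_shift_def by - (intro conjI)
  moreover have "card (lift S) = x0 + (\<Sum>r\<in>R - {r0}. x r)"
    using card_lift[of S] ST ST0 ST1 r0 fin_R by (simp add: sum.remove[of R r0] S_def)
  moreover have "card (lift T) = z0 + (\<Sum>r\<in>R - {r0}. z r)"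
    using card_lift[of T] ST ST0 ST1 r0 fin_R by (simp add: sum.remove[of R r0] T_def)
  ultimately show ?thesis unfolding rooted_def by blast
qed

lemma rooted_of_block_list:
  assumes base: "base_block p a b x0 z0"
    and blocks: "\<And>x z. (x, z) \<in> set bs \<Longrightarrow> block p a b x z"
    and len: "length bs + 1 = card R"
  shows "rooted G (x0 + sum_list (map fst bs)) (z0 + sum_list (map snd bs))"
proof -
  have "card (R - {r0}) = length bs" using len r0 fin_R by simp
  then obtain e where e: "bij_betw e {..<length bs} (R - {r0})"
    using fin_R by (metis card_lessThan finite_Diff finite_lessThan finite_same_card_bij)
  define k where "k r = bs ! inv_into {..<length bs} e r" for r
  have k: "k (e i) = bs ! i" if "i < length bs" for i
    using e that by (simp add: k_def bij_betw_def)
  have "block p a b (fst (k r)) (snd (k r))" if "r \<in> R - {r0}" for r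
  proof -
    have "r \<in> e ` {..<length bs}" using e that by (simp add: bij_betw_def)
    then obtain i where "i < length bs" "r = e i" by auto
    then show ?thesis using blocks[of "fst (bs ! i)" "snd (bs ! i)"] by (simp add: k)
  qed
  from rooted_of_blocks[OF base this] have
    "rooted G (x0 + (\<Sum>r\<in>R - {r0}. fst (k r))) (z0 + (\<Sum>r\<in>R - {r0}. snd (k r)))" by simp
  moreover have "(\<Sum>r\<in>R - {r0}. f (k r)) = sum_list (map f bs)" for f :: "nat \<times> nat \<Rightarrow> nat"
  proof -
    have "(\<Sum>r\<in>R - {r0}. f (k r)) = (\<Sum>i<length bs. f (k (e i)))"
      by (rule sum.reindex_bij_betw[OF e, symmetric])
    also have "\<dots> = sum_list (map f bs)"
      by (simp add: k sum_list_sum_nth atLeast0LessThan)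
    finally show ?thesis .
  qed
  ultimately show ?thesis by simp
qed

text \<open>The list \<open>bs\<close> is padded with \<open>i\<close> cosets wholly labelling
  \<open>X\<close>, \<open>j\<close> wholly labelling \<open>Z\<close> and \<open>l\<close> wholly
  labelling \<open>Y\<close>; these are blocks for every choice of \<open>a\<close> and
  \<open>b\<close>.\<close>

lemma rooted_of_blocks_mod:
  assumes base: "base_block p a b x0 z0"
    and blocks: "\<And>x z. (x, z) \<in> set bs \<Longrightarrow> block p a b x z"
    and len: "length bs + 1 + i + j + l = card R"
    and x: "x = x0 + sum_list (map fst bs) + nat p * i"
    and z: "z = z0 + sum_list (map snd bs) + nat p * j"
  shows "rooted G x z"
proof -
  define bs' where
    "bs' = bs @ replicate i (nat p, 0) @ replicate j (0, nat p) @ replicate l (0, 0)"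
  have "rooted G (x0 + sum_list (map fst bs')) (z0 + sum_list (map snd bs'))"
  proof (rule rooted_of_block_list[OF base])
    show "block p a b x z" if "(x, z) \<in> set bs'" for x z
      using that blocks block_full[OF p_pos, of a b] unfolding bs'_def by (auto split: if_splits)
    show "length bs' + 1 = card R" using len by (simp add: bs'_def)
  qed
  then show ?thesis unfolding x z bs'_def by (simp add: sum_list_replicate ac_simps)
qed

text \<open>The one case where \<open>a\<close> must lie outside the subgroup generated by \<open>b\<close>: here \<open>m = 2 b\<close>, and
  the cycle of \<open>0\<close> runs through every multiple of \<open>b\<close> other than \<open>b\<close> itself.\<close>

lemma rooted_no_translation_by_a:
  assumes p3: "p \<ge> 3" and card: "j + l + 2 = card R"
  shows "rooted G 0 (nat p - 2 + nat p * j)"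
proof -
  have "card (R - {r0}) = j + l + 1" using card r0 fin_R by simp
  then obtain r1 where r1: "r1 \<in> R - {r0}" by (metis card_eq_0_iff add_is_0 equals0I one_neq_zero)
  have "card (R - {r0, r1}) = j + l" using card r0 r1 fin_R by (auto simp: card_Diff_subset)
  then obtain J where J: "J \<subseteq> R - {r0, r1}" "card J = j"
    by (metis obtain_subset_with_card_n le_add1)
  \<comment> \<open>In the subgroup the positions from \<open>2\<close> on advance by one, the last
    of them to the vacant \<open>0\<close>. The coset \<open>r1\<close> stays fixed because it
    contains the label \<open>h 0 r1\<close> of \<open>s1\<close>.\<close>
  define T where "T r = (if r = r0 then {2..<p} else if r \<in> J then {0..<p} else {})" for r
  have T: "T r \<subseteq> {0..<p}" for r by (auto simp: T_def)
  have sh: "shift G (h 0 r1) (h 1 r0) {} (lift T) (h i r) =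
      h (if i \<in> T r then (i + 1) mod p else i) r"
    if "i \<in> {0..<p}" "r \<in> R" for i r
    using that p3 h_mult[of i 1 r] T by (auto simp: shift_def mem_lift)
  have mod_inj: "i = j" if "(i + 1) mod p = (j + 1) mod p" "i \<in> {0..<p}" "j \<in> {0..<p}" for i j
  proof -
    have "[i = j] (mod p)" using that by (simp add: cong_def[symmetric] cong_add_rcancel)
    then show ?thesis using that by (simp add: cong_def)
  qed
  have "inj_on (shift G (h 0 r1) (h 1 r0) {} (lift T)) (carrier G - {\<one>})"
  proof (rule inj_onI)
    fix u v assume u: "u \<in> carrier G - {\<one>}" and v: "v \<in> carrier G - {\<one>}"
      and eq: "shift G (h 0 r1) (h 1 r0) {} (lift T) u = shift G (h 0 r1) (h 1 r0) {} (lift T) v"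
    obtain i r where i: "i \<in> {0..<p}" "r \<in> R" "u = h i r" using u h_cases by blast
    obtain j s where j: "j \<in> {0..<p}" "s \<in> R" "v = h j s" using v h_cases by blast
    have rs: "r = s" "(if i \<in> T r then (i + 1) mod p else i) = (if j \<in> T r then (j + 1) mod p else j)"
      using eq i j p_pos by (auto simp: sh h_eq_iff split: if_splits)
    have ij: "r = r0 \<Longrightarrow> i \<noteq> 0" "r = r0 \<Longrightarrow> j \<noteq> 0" using i j u v h_zero rs by auto
    have "i = j"
    proof (cases "r = r0")
      case True
      have "(c + 1) mod p = (if c = p - 1 then 0 else c + 1)" if "c \<in> {0..<p}" for c
        using that by auto
      then show ?thesis using rs(2) i j ij True by (auto simp: T_def split: if_splits)
    next
      case False
      then show ?thesis using rs(2) mod_inj[of i j] i j by (auto simp: T_def split: if_splits)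
    qed
    then show "u = v" using i j rs by simp
  qed
  moreover have "h 0 r1 \<in> carrier G - {\<one>}" "h 1 r0 \<in> carrier G - {\<one>}" "h 0 r1 \<noteq> h 1 r0"
    using r0 r1 p3 by (auto simp: h_zero[symmetric] h_eq_iff)
  moreover have "h 0 r0 \<notin> lift T" "h 0 r1 \<notin> lift T" "h 1 r0 \<notin> lift T"
  proof -
    have "h c r \<in> lift T \<longleftrightarrow> c \<in> T r" if "c \<in> {0..<p}" "r \<in> R" for c r
      using mem_lift[OF that] T by blast
    then show "h 0 r0 \<notin> lift T" "h 0 r1 \<notin> lift T" "h 1 r0 \<notin> lift T"
      using J r0 r1 p3 by (auto simp: T_def)
  qed
  then have "lift T \<subseteq> carrier G - {\<one>, h 0 r1, h 1 r0}"
    using lift_subset[of T, OF T] unfolding h_zero[symmetric] by auto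
  ultimately have "rooted_shift G (h 0 r1) (h 1 r0) {} (lift T)"
    unfolding rooted_shift_def by - (intro conjI; (assumption | simp))
  moreover have "card (lift T) = nat p - 2 + nat p * j"
  proof -
    have "card (lift T) = (\<Sum>r\<in>R. card (T r))" using card_lift T by blast
    also have "\<dots> = card (T r0) + (\<Sum>r\<in>R - {r0}. card (T r))" using r0 fin_R by (simp add: sum.remove)
    also have "(\<Sum>r\<in>R - {r0}. card (T r)) = (\<Sum>r\<in>J. card (T r))"
      using J fin_R by (intro sum.mono_neutral_right) (auto simp: T_def)
    also have "\<dots> = (\<Sum>r\<in>J. nat p)" using J by (intro sum.cong) (auto simp: T_def)
    also have "card (T r0) = nat p - 2" by (simp add: T_def nat_diff_distrib)
    finally show ?thesis using J by (simp add: mult.commute)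
  qed
  ultimately show ?thesis unfolding rooted_def using card.empty by blast
qed

end

section \<open>Coordinates on the group \<open>Zmod_power p k\<close>\<close>

lemma comm_group_Zmod_power: "comm_group (Zmod_power p k)"
proof (rule group.group_comm_groupI)
  show "group (Zmod_power p k)"
    unfolding Zmod_power_def by (rule product_group) simp
qed (auto simp: Zmod_power_def add.commute)

lemma carrier_Zmod_power:
  "p > 0 \<Longrightarrow> carrier (Zmod_power p k) = {..<k} \<rightarrow>\<^sub>E {0..<int p}"
  by (simp add: Zmod_power_def carrier_integer_mod_group)

lemma card_Zmod_power: "p > 0 \<Longrightarrow> card (carrier (Zmod_power p k)) = p ^ k"
  by (simp add: carrier_Zmod_power card_PiE)

lemma finite_Zmod_power: "p > 0 \<Longrightarrow> finite (carrier (Zmod_power p k))"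
  by (simp add: carrier_Zmod_power finite_PiE)

lemma mult_Zmod_power:
  "x \<otimes>\<^bsub>Zmod_power p k\<^esub> y = (\<lambda>i\<in>{..<k}. (x i + y i) mod int p)"
  by (simp add: Zmod_power_def)

lemma one_Zmod_power: "\<one>\<^bsub>Zmod_power p k\<^esub> = (\<lambda>i\<in>{..<k}. 0)"
  by (simp add: Zmod_power_def)

lemma Zmod_power_exponent:
  assumes p: "p > 0" and x: "x \<in> carrier (Zmod_power p k)"
  shows "x [^]\<^bsub>Zmod_power p k\<^esub> p = \<one>\<^bsub>Zmod_power p k\<^esub>"
proof -
  interpret comm_group "Zmod_power p k" by (rule comm_group_Zmod_power)
  have "x [^]\<^bsub>Zmod_power p k\<^esub> n = (\<lambda>i\<in>{..<k}. (int n * x i) mod int p)" for n :: nat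
  proof (induction n)
    case 0 show ?case by (simp add: one_Zmod_power)
  next
    case (Suc n)
    show ?case unfolding nat_pow_Suc Suc mult_Zmod_power
      by (rule restrict_ext) (simp add: distrib_right mod_simps add.commute)
  qed
  then show ?thesis by (auto simp: one_Zmod_power intro!: restrict_ext)
qed

text \<open>The subgroup is the axis of coordinate \<open>0\<close>; its cosets are represented by
  the vectors that vanish in this coordinate.\<close>

lemma coset_coordinates_Zmod_power:
  assumes p: "p > 0" and k: "k > 0"
  shows "coset_coordinates (Zmod_power p k) (int p)
    {r \<in> carrier (Zmod_power p k). r 0 = 0} \<one>\<^bsub>Zmod_power p k\<^esub> (\<lambda>i r. r(0 := i))"
proof -
  interpret comm_group "Zmod_power p k" by (rule comm_group_Zmod_power)
  let ?C = "carrier (Zmod_power p k)"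
  let ?R = "{r \<in> ?C. r 0 = 0}"
  have mem: "v(0 := i) \<in> ?C" if "v \<in> ?C" "i \<in> {0..<int p}" for v i
    using that k p unfolding carrier_Zmod_power[OF p] by (auto simp: PiE_iff extensional_def)
  have val: "v i \<in> {0..<int p}" if "v \<in> ?C" "i < k" for v i
    using that PiE_mem[of v "{..<k}" "\<lambda>_. {0..<int p}" i] by (simp add: carrier_Zmod_power[OF p])
  show ?thesis
  proof unfold_locales
    show "int p > 0" using p by simp
    show "finite ?R" using finite_Zmod_power[OF p] by simp
    show "\<one>\<^bsub>Zmod_power p k\<^esub> \<in> ?R" using k one_closed by (auto simp: one_Zmod_power)
    show "bij_betw (\<lambda>(r, i). r(0 := i)) (?R \<times> {0..<int p}) ?C"
    proof (rule bij_betw_byWitness[where f' = "\<lambda>v. (v(0 := 0), v 0)"])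
      show "(\<lambda>v. (v(0 := 0), v 0)) ` ?C \<subseteq> ?R \<times> {0..<int p}"
        using mem[of _ 0] val[of _ 0] k p by auto
      show "(\<lambda>(r, i). r(0 := i)) ` (?R \<times> {0..<int p}) \<subseteq> ?C" using mem by auto
    qed (auto simp: fun_eq_iff)
    show "(\<one>\<^bsub>Zmod_power p k\<^esub>)(0 := 0) = \<one>\<^bsub>Zmod_power p k\<^esub>"
      using k by (auto simp: one_Zmod_power)
    fix i c r assume "i \<in> {0..<int p}" "c \<in> {0..<int p}" and r: "r \<in> ?R"
    have "r j mod int p = r j" if "j < k" for j using val[of r j] r that by simp
    moreover have "r j = undefined" if "\<not> j < k" for j
      using r that unfolding carrier_Zmod_power[OF p] by auto
    ultimately show "r(0 := i) \<otimes>\<^bsub>Zmod_power p k\<^esub> (\<one>\<^bsub>Zmod_power p k\<^esub>)(0 := c) =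
        r(0 := (i + c) mod int p)"
      using k by (auto simp: mult_Zmod_power one_Zmod_power restrict_def fun_eq_iff)
  qed
qed

section \<open>Explicit configurations\<close>

text \<open>Here \<open>t\<close> is the inverse of \<open>2\<close> modulo \<open>p\<close>. The
  positions from \<open>t - \<alpha>\<close> to \<open>t - 2\<close> advance by one, and
  \<open>t - 1\<close> jumps by \<open>t\<close> onto \<open>p\<close>, that is, onto the vacant
  \<open>0\<close>.\<close>

lemma base_block_half:
  assumes p: "p = 2 * t - 1" and \<alpha>: "1 \<le> \<alpha>" "int \<alpha> + 2 \<le> t"
  shows "base_block p 1 t (\<alpha> - 1) 1"
proof (rule base_blockI[where c = 0 and a' = 1 and b' = t and S = "{t - int \<alpha>..<t - 1}"
      and T = "{t - 1}" and d = 0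
      and \<psi> = "\<lambda>v. if v \<in> {t - int \<alpha>..<t - 1} then v + 1 else if v = t - 1 then 0 else v"])
  show "inj_on (\<lambda>v. if v \<in> {t - int \<alpha>..<t - 1} then v + 1 else if v = t - 1 then 0 else v)
    ({0..<0 + p} - {0})"
    unfolding inj_on_def by auto
  show "[(if v \<in> {t - int \<alpha>..<t - 1} then v + 1 else if v = t - 1 then 0 else v) = v + t] (mod p)"
    if "v \<in> {t - 1}" for v
  proof -
    have "v + t = p" using that p by simp
    then show ?thesis using that by (simp add: cong_def)
  qed
qed (use assms in \<open>auto\<close>)

text \<open>The labels of \<open>s1\<close> and \<open>s3\<close> are \<open>1\<close> and \<open>3\<close>. Up to \<open>2 * n\<close> a single cycle advances from \<open>2\<close>,
  first by \<open>r + 1\<close> steps of length \<open>3\<close> and then by steps of length \<open>1\<close>; beyond \<open>2 * n\<close>,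
  steps of length \<open>3\<close> from even numbers alternate with steps of length \<open>1\<close> from odd ones.\<close>

lemma base_block_three:
  assumes p: "p = 2 * q + 1" and n: "3 \<le> n" "n \<le> q" and h: "h = n \<or> h = n + 1" "h \<le> q"
    and r: "0 \<le> r" "3 * r + 5 \<le> 2 * n"
  shows "base_block p 1 3 (nat (2 * n - 5 - 3 * r + q - h)) (nat (2 + r + q - n))"
proof -
  define S1 where "S1 = {5 + 3 * r..<2 * n}"
  define S2 where "S2 = (\<lambda>i. 2 * i + 1) ` {h..<q}"
  define T1 where "T1 = (\<lambda>i. 5 + 3 * i) ` {0..<r}"
  define T2 where "T2 = (\<lambda>i. 2 * i) ` {n..q}"
  have S2: "v \<in> S2 \<longleftrightarrow> odd v \<and> 2 * h < v \<and> v < 2 * q" for v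
    unfolding S2_def by (auto elim!: oddE intro!: image_eqI[of _ _ "(v - 1) div 2"])
  have T1: "v \<in> T1 \<longleftrightarrow> (v - 5) mod 3 = 0 \<and> 5 \<le> v \<and> v < 5 + 3 * r" for v
    unfolding T1_def by (auto intro!: image_eqI[of _ _ "(v - 5) div 3"])
  have T2: "v \<in> T2 \<longleftrightarrow> even v \<and> 2 * n \<le> v \<and> v \<le> 2 * q" for v
    unfolding T2_def by (auto elim!: evenE)
  have S1: "v \<in> S1 \<longleftrightarrow> 5 + 3 * r \<le> v \<and> v < 2 * n" for v by (auto simp: S1_def)
  define \<psi> where "\<psi> v = (if v = 2 * q then 2 else if v = 2 then 5
    else if v \<ge> 2 * n then (if even v then v + 3 else if v > 2 * h then v + 1 else v)
    else if 5 + 3 * r \<le> v then v + 1 else if 5 \<le> v \<and> (v - 5) mod 3 = 0 then v + 3 else v)" for v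
  \<comment> \<open>A left inverse of \<open>\<psi>\<close> on \<open>1, ..., p - 1\<close>; it
    replaces the comparison of all pairs of branches in the proof of injectivity.\<close>
  define g where "g w = (if w = 2 then 2 * q else if w = 5 then 2
    else if w > 2 * n then (if odd w then (if w \<ge> 2 * n + 3 then w - 3 else w) else w - 1)
    else if w > 5 + 3 * r then w - 1 else if w > 5 \<and> (w - 5) mod 3 = 0 then w - 3 else w)" for w
  have inv: "g (\<psi> v) = v" if "1 \<le> v" "v < p" for v
  proof -
    consider "v = 2 * q" | "v = 2" | "v \<noteq> 2 * q" "v \<ge> 2 * n" "even v"
      | "v \<noteq> 2 * q" "v \<ge> 2 * n" "odd v" "v > 2 * h" | "v \<noteq> 2 * q" "v \<ge> 2 * n" "odd v" "v \<le> 2 * h"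
      | "5 + 3 * r \<le> v" "v < 2 * n" | "v \<noteq> 2" "v < 5 + 3 * r" "5 \<le> v \<and> (v - 5) mod 3 = 0"
      | "v \<noteq> 2" "v < 5 + 3 * r" "\<not> (5 \<le> v \<and> (v - 5) mod 3 = 0)"
      using r by linarith
    then show ?thesis
    proof cases
      case 7
      then have "v + 3 \<le> 5 + 3 * r" by presburger
      moreover have "(v + 3 - 5) mod 3 = 0" using 7 by presburger
      ultimately show ?thesis using 7 n h r by (simp add: \<psi>_def g_def)
    next
      case 8
      have "\<not> (v > 5 \<and> (v - 5) mod 3 = 0)" "v \<noteq> 5" using 8 by auto
      then show ?thesis using 8 n h r by (simp add: \<psi>_def g_def)
    next
      case 5
      \<comment> \<open>The only odd number between \<open>2 * n\<close> and \<open>2 * h\<close>,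
        occurring when \<open>h = n + 1\<close>. It stays fixed, so this choice of \<open>h\<close>
        saves one unit step.\<close>
      then have "v = 2 * n + 1" using h by presburger
      then show ?thesis using 5 n h r by (simp add: \<psi>_def g_def)
    qed (use n h r in \<open>auto simp: \<psi>_def g_def\<close>)
  qed
  show ?thesis
  proof (rule base_blockI[where c = 0 and a' = 1 and b' = 3 and S = "S1 \<union> S2"
        and T = "{2} \<union> T1 \<union> T2" and d = 1 and \<psi> = \<psi>])
    show "inj_on \<psi> ({0..<0 + p} - {0})"
      by (rule inj_on_inverseI[where g = g]) (simp add: inv)
    show "\<psi> ` ({0..<0 + p} - {0}) \<subseteq> {1..<1 + p}"
    proof
      fix w assume "w \<in> \<psi> ` ({0..<0 + p} - {0})"
      then obtain v where "w = \<psi> v" "v \<in> {0..<0 + p} - {0}" by (rule imageE)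
      then have v: "w = \<psi> v" "1 \<le> v" "v \<le> 2 * q" using p by auto
      have "even v \<Longrightarrow> v \<noteq> 2 * q \<Longrightarrow> v + 3 \<le> 2 * q + 1" using v by presburger
      moreover have "v < 5 + 3 * r \<Longrightarrow> (v - 5) mod 3 = 0 \<Longrightarrow> v + 3 \<le> 2 * q + 1"
        using n r by presburger
      ultimately show "w \<in> {1..<1 + p}" using v n h r p by (auto simp: \<psi>_def)
    qed
    show "[\<psi> v = v + 1] (mod p)" if "v \<in> S1 \<union> S2" for v
      using that n h r by (auto simp: S1 S2 \<psi>_def)
    show "[\<psi> v = v + 3] (mod p)" if mem: "v \<in> {2} \<union> T1 \<union> T2" for v
    proof -
      consider "v = 2" | "v \<in> T1" | "v = 2 * q" | "v \<in> T2" "v \<noteq> 2 * q" using mem by blast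
      then show ?thesis
      proof cases
        case 1 then show ?thesis using n by (simp add: \<psi>_def)
      next
        case 2 then show ?thesis using n r by (auto simp: T1 \<psi>_def)
      next
        case 3
        \<comment> \<open>\<open>2 * q + 3\<close> is \<open>p + 2\<close>, so this step wraps
          around to \<open>2\<close>.\<close>
        then have "\<psi> v + p * 1 = v + 3" using p by (simp add: \<psi>_def)
        then show ?thesis by (metis cong_iff_lin)
      next
        case 4 then show ?thesis using n by (auto simp: T2 \<psi>_def)
      qed
    qed
    show "[\<psi> v = v] (mod p)" if "v \<in> {0..<0 + p} - {0} - (S1 \<union> S2) - ({2} \<union> T1 \<union> T2)" for v
    proof -
      have v: "v < p" "v \<noteq> 0" "v \<noteq> 2" "\<not> (5 + 3 * r \<le> v \<and> v < 2 * n)"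
        "\<not> (odd v \<and> 2 * h < v \<and> v < 2 * q)" "\<not> ((v - 5) mod 3 = 0 \<and> 5 \<le> v \<and> v < 5 + 3 * r)"
        "\<not> (even v \<and> 2 * n \<le> v \<and> v \<le> 2 * q)"
        using that S1[of v] S2[of v] T1[of v] T2[of v] by simp_all
      have "\<psi> v = v"
      proof (cases "v \<ge> 2 * n")
        case True
        then have "odd v" "v \<noteq> 2 * q" "\<not> 2 * h < v" using v p by auto
        then show ?thesis using v True by (simp add: \<psi>_def)
      next
        case False
        then have "\<not> 5 + 3 * r \<le> v" "\<not> (5 \<le> v \<and> (v - 5) mod 3 = 0)" using v by auto
        then show ?thesis using False v n by (simp only: \<psi>_def) simp
      qed
      then show ?thesis by simp
    qed
    show "S1 \<union> S2 \<subseteq> {0..<0 + p} - {0, 1, 3}" using n h r p by (auto simp: S1 S2)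
    show "{2} \<union> T1 \<union> T2 \<subseteq> {0..<0 + p} - {0, 1, 3}" using n h r p by (auto simp: T1 T2)
    show "(S1 \<union> S2) \<inter> ({2} \<union> T1 \<union> T2) = {}" using n h r by (auto simp: S1 S2 T1 T2)
    have fin: "finite S1" "finite S2" "finite T1" "finite T2"
      by (auto simp: S1_def S2_def T1_def T2_def)
    have card2: "card S2 = nat (q - h)" "card T1 = nat r" "card T2 = nat (q + 1 - n)"
      unfolding S2_def T1_def T2_def by (auto simp: card_image inj_on_def)
    have "S1 \<inter> S2 = {}" using h by (auto simp: S1 S2)
    then have "card (S1 \<union> S2) = nat (2 * n - (5 + 3 * r)) + nat (q - h)"
      using fin card2 by (simp add: card_Un_disjoint S1_def)
    then show "card (S1 \<union> S2) = nat (2 * n - 5 - 3 * r + q - h)" using n h r by simp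
    have "T1 \<inter> T2 = {}" "2 \<notin> T1 \<union> T2" using n r by (auto simp: T1 T2)
    then have "card ({2} \<union> T1 \<union> T2) = 1 + nat r + nat (q + 1 - n)"
      using fin card2 by (simp add: card_Un_disjoint)
    then show "card ({2} \<union> T1 \<union> T2) = nat (2 + r + q - n)" using n h r by simp
  qed (use n h r p in auto)
qed

text \<open>If \<open>A * s mod p + C * s mod p < p\<close> defines the set of \<open>s\<close>, then exactly one of \<open>s\<close> and \<open>- s\<close>
  belongs to it, \<open>- 1\<close> does and \<open>1\<close> does not. If \<open>1\<close> were not a sum of two of its
  elements, it would be closed under \<open>s \<mapsto> s - 1\<close> and hence contain \<open>1\<close>.\<close>

lemma proportional_split:
  fixes p A C :: int
  assumes p: "prime p" and A: "0 < A" "A < p" and C: "0 < C" "C < p" and AC: "p < A + C"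
  obtains X Z where "0 < X" "X \<le> A" "0 < Z" "Z \<le> C" "X + Z < p" "(A - X) + (C - Z) < p"
    "p dvd X * C - Z * A"
proof -
  define T where "T s \<longleftrightarrow> s * A mod p + s * C mod p < p" for s
  have p0: "p > 0" using A by simp
  have nz: "s * B mod p \<noteq> 0" if "0 < s" "s < p" "0 < B" "B < p" for s B
    using that p zdvd_not_zless[of s p] zdvd_not_zless[of B p]
    by (auto simp: mod_eq_0_iff_dvd prime_dvd_mult_iff)
  have neg: "(p - s) * B mod p = p - s * B mod p" if "0 < s" "s < p" "0 < B" "B < p" for s B
  proof -
    have "(p - s) * B mod p = (- (s * B)) mod p" by (simp add: left_diff_distrib mod_diff_left_eq[symmetric])
    then show ?thesis using nz[OF that] by (simp add: zmod_zminus1_eq_if)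
  qed
  have compl: "T s \<or> T (p - s)" if s: "0 < s" "s < p" for s
  proof (rule ccontr)
    assume n: "\<not> (T s \<or> T (p - s))"
    \<comment> \<open>The sums belonging to \<open>s\<close> and \<open>p - s\<close> add up to
      \<open>2 * p\<close>; if neither is below \<open>p\<close>, both equal
      \<open>p\<close>.\<close>
    then have "s * A mod p + s * C mod p = p"
      using neg[OF s A] neg[OF s C] by (simp add: T_def)
    moreover have "p dvd s * (A + C) \<longleftrightarrow> p dvd s * A mod p + s * C mod p"
      by (simp add: distrib_left mod_simps flip: mod_eq_0_iff_dvd)
    ultimately have "p dvd A + C" using p s zdvd_not_zless[of s p] by (auto simp: prime_dvd_mult_iff)
    then have "p dvd A + C - p" by simp
    then show False using zdvd_not_zless[of "A + C - p" p] AC A C by auto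
  qed
  have "\<exists>s. 2 \<le> s \<and> s < p \<and> T s \<and> T (p + 1 - s)"
  proof (rule ccontr)
    assume no: "\<not> ?thesis"
    have step: "T (s - 1)" if "2 \<le> s" "s < p" "T s" for s
      using no that compl[of "s - 1"] by (auto simp: algebra_simps)
    have "T (p - 1)" using neg[of 1 A] neg[of 1 C] A C AC by (simp add: T_def)
    then have "T (p - 1 - int n)" if "int n \<le> p - 2" for n
      using that by (induction n) (use step[of "p - 1 - int _"] in \<open>auto simp: algebra_simps\<close>)
    from this[of "nat (p - 2)"] have "T 1" using p prime_ge_2_int[of p] by simp
    then show False using A C AC by (simp add: T_def)
  qed
  then obtain s where s: "2 \<le> s" "s < p" "T s" "T (p + 1 - s)" by auto
  define X where "X = s * A mod p"
  define Z where "Z = s * C mod p"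
  define X' where "X' = (p + 1 - s) * A mod p"
  define Z' where "Z' = (p + 1 - s) * C mod p"
  have "X \<noteq> 0" "Z \<noteq> 0" using nz[of s A] nz[of s C] s A C by (simp_all add: X_def Z_def)
  moreover have "0 \<le> X" "0 \<le> Z" "0 \<le> X'" "0 \<le> Z'"
    using p0 by (simp_all add: X_def Z_def X'_def Z'_def)
  moreover have "X + Z < p" "X' + Z' < p"
    using s by (simp_all add: T_def X_def Z_def X'_def Z'_def)
  ultimately have bounds: "0 < X" "0 < Z" "0 \<le> X'" "0 \<le> Z'" "X + Z < p" "X' + Z' < p"
    by simp_all
  have wrap: "\<exists>i. s * B mod p + (p + 1 - s) * B mod p = B + p * i" for B
  proof -
    have "[s * B mod p + (p + 1 - s) * B mod p = s * B + (p + 1 - s) * B] (mod p)"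
      by (simp add: cong_def mod_simps)
    also have "[s * B + (p + 1 - s) * B = B] (mod p)"
      by (simp add: cong_iff_dvd_diff algebra_simps)
    finally have "[B = s * B mod p + (p + 1 - s) * B mod p] (mod p)" by (rule cong_sym)
    then show ?thesis by (simp add: cong_iff_lin)
  qed
  \<comment> \<open>Nonnegativity of the four remainders excludes negative \<open>i\<close> and
    \<open>j\<close>. Their total is below \<open>2 * p\<close>, which with \<open>p < A + C\<close>
    excludes a positive \<open>i + j\<close>. So the sums are exactly \<open>A\<close> and
    \<open>C\<close>.\<close>
  obtain i j where ij: "X + X' = A + p * i" "Z + Z' = C + p * j"
    using wrap[of A] wrap[of C] unfolding X_def Z_def X'_def Z'_def by auto
  have "i \<ge> 0"
  proof (rule ccontr)
    assume "\<not> 0 \<le> i" then have "p * i \<le> p * (-1)" using p0 by (intro mult_left_mono) auto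
    then show False using ij bounds A by simp
  qed
  moreover have "j \<ge> 0"
  proof (rule ccontr)
    assume "\<not> 0 \<le> j" then have "p * j \<le> p * (-1)" using p0 by (intro mult_left_mono) auto
    then show False using ij bounds C by simp
  qed
  moreover have "i + j \<le> 0"
  proof (rule ccontr)
    assume "\<not> i + j \<le> 0" then have "p * 1 \<le> p * (i + j)" using p0 by (intro mult_left_mono) auto
    then show False using ij bounds AC by (simp add: distrib_left)
  qed
  ultimately have "X + X' = A" "Z + Z' = C" using ij by auto
  moreover have "[X * C = Z * A] (mod p)"
  proof -
    have "[X * C = s * A * C] (mod p)" "[Z * A = s * C * A] (mod p)"
      unfolding X_def Z_def by (simp_all add: cong_def mod_mult_left_eq)
    then show ?thesis by (simp add: cong_def ac_simps)
  qed
  ultimately show thesis using that[of X Z] bounds by (simp add: cong_iff_dvd_diff)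
qed

text \<open>The number of cosets left entirely to \<open>Y\<close> follows from the order of the
  group. The last hypothesis says precisely that this number is not negative.\<close>

lemma rooted_Zmod_of_blocks:
  assumes p: "p > 0" and k: "k > 0" and total: "x + y + z + 3 = p ^ k"
    and base: "base_block (int p) a b x0 z0"
    and blocks: "\<And>u w. (u, w) \<in> set bs \<Longrightarrow> block (int p) a b u w"
    and x: "x = x0 + sum_list (map fst bs) + p * i"
    and z: "z = z0 + sum_list (map snd bs) + p * j"
    and y: "p * length bs < x0 + sum_list (map fst bs) + (z0 + sum_list (map snd bs)) + y + 3"
  shows "rooted (Zmod_power p k) x z"
proof -
  let ?G = "Zmod_power p k"
  interpret coset_coordinates ?G "int p" "{r \<in> carrier ?G. r 0 = 0}" "\<one>\<^bsub>?G\<^esub>" "\<lambda>i r. r(0 := i)"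
    by (rule coset_coordinates_Zmod_power[OF p k])
  let ?R = "{r \<in> carrier ?G. r 0 = 0}"
  define N where "N = card ?R"
  have R: "N * p = p ^ k" unfolding N_def
    using bij_betw_same_card[OF bij_h] by (simp add: card_cartesian_product card_Zmod_power[OF p])
  define c where "c = x0 + sum_list (map fst bs) + (z0 + sum_list (map snd bs)) + y + 3"
  have c: "c + p * (i + j) = N * p"
    unfolding R total[symmetric] x z c_def by (simp add: distrib_left)
  have "p dvd c + p * (i + j)" unfolding c by simp
  then have "p dvd c" by (simp add: dvd_add_left_iff)
  then obtain m where m: "c = p * m" by auto
  then have "length bs < m" using y by (simp add: c_def[symmetric])
  then obtain l where "m = length bs + 1 + l" by (auto simp: less_iff_Suc_add)
  then have "p * (length bs + 1 + i + j + l) = p * N" using c m by (simp add: algebra_simps)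
  then have "length bs + 1 + i + j + l = card ?R" unfolding N_def[symmetric] using p by (simp only: nat_mult_eq_cancel1)
  from rooted_of_blocks_mod[OF base blocks this] x z show ?thesis by simp
qed

section \<open>Sufficiency: a configuration for each range of the residues\<close>

context
  fixes p k x y z :: nat
  assumes p: "prime p" "p \<ge> 5" and k: "k > 0" and total: "x + y + z + 3 = p ^ k"
begin

lemma blockI:
  assumes "0 < a" "a < int p" "0 < b" "b < int p" "u + w \<le> p" "int p dvd int u * a + int w * b"
  shows "block (int p) a b u w"
  using p assms zdvd_not_zless[of a "int p"] zdvd_not_zless[of b "int p"]
  by (intro block_zero_sum) auto

lemma rooted_small_sum:
  assumes "x = \<alpha> + p * i" "z = \<gamma> + p * j" "\<alpha> + \<gamma> + 3 \<le> p"
  shows "rooted (Zmod_power p k) x z"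
  using base_block_swap[of "int p" \<alpha> \<gamma>] p k total assms
  by (intro rooted_Zmod_of_blocks[where bs = "[]" and i = i and j = j]) auto

text \<open>With \<open>b = - a\<close> any balanced pair sums to zero; the residues are halved over
  two cosets and nothing moves in the subgroup.\<close>

lemma rooted_maximal:
  assumes "x = p - 1 + p * i" "z = p - 1 + p * j"
  shows "rooted (Zmod_power p k) x z"
proof -
  have "odd p" using p prime_odd_nat[of p] by simp
  then obtain q where q: "p = 2 * q + 1" by (auto elim: oddE)
  have "int p dvd int q * 1 + int q * (int p - 1)"
    by (rule dvdI[of _ _ "int q"]) (simp add: algebra_simps)
  then have 1: "block (int p) 1 (int p - 1) q q" using q p by (intro blockI) auto
  show ?thesis using base_block_trivial[of 1 "int p" "int p - 1"] p k total assms q 1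
    by (intro rooted_Zmod_of_blocks[where bs = "[(q, q), (q, q)]" and i = i and j = j]) auto
qed

text \<open>A base block with counts \<open>X - 1\<close> and \<open>Z - 1\<close> has
  \<open>a = - Z\<close> and \<open>b = X\<close>. The remaining translations then sum to zero
  exactly when \<open>X * (\<gamma> + 1)\<close> and \<open>Z * (\<alpha> + 1)\<close> agree modulo
  \<open>p\<close>, which \<open>proportional_split\<close> arranges while bounding both
  blocks.\<close>

lemma rooted_large_sum:
  assumes "x = \<alpha> + p * i" "z = \<gamma> + p * j" "\<alpha> + 1 < p" "\<gamma> + 1 < p" "p < \<alpha> + \<gamma> + 2"
  shows "rooted (Zmod_power p k) x z"
proof -
  obtain X Z where XZ: "0 < X" "X \<le> int \<alpha> + 1" "0 < Z" "Z \<le> int \<gamma> + 1" "X + Z < int p"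
    "(int \<alpha> + 1 - X) + (int \<gamma> + 1 - Z) < int p" "int p dvd X * (int \<gamma> + 1) - Z * (int \<alpha> + 1)"
    using proportional_split[of "int p" "int \<alpha> + 1" "int \<gamma> + 1"] p assms by auto
  define x0 where "x0 = nat (X - 1)"
  define z0 where "z0 = nat (Z - 1)"
  have X: "X = int x0 + 1" "Z = int z0 + 1" using XZ by (auto simp: x0_def z0_def)
  have le: "x0 \<le> \<alpha>" "z0 \<le> \<gamma>" "x0 + z0 + 3 \<le> p" "\<alpha> - x0 + (\<gamma> - z0) \<le> p" using XZ X by auto
  have base: "base_block (int p) (int p - int z0 - 1) (int x0 + 1) x0 z0"
    using base_block_swap[of "int p" x0 z0] le p by simp
  have "int (\<alpha> - x0) * (int p - int z0 - 1) + int (\<gamma> - z0) * (int x0 + 1) =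
      int p * (int \<alpha> - int x0) + (X * (int \<gamma> + 1) - Z * (int \<alpha> + 1))"
    using le X by (simp add: of_nat_diff algebra_simps)
  then have "block (int p) (int p - int z0 - 1) (int x0 + 1) (\<alpha> - x0) (\<gamma> - z0)"
    using XZ le by (intro blockI) auto
  then show ?thesis using base p k total assms le
    by (intro rooted_Zmod_of_blocks[where bs = "[(\<alpha> - x0, \<gamma> - z0)]" and i = i and j = j]) auto
qed

text \<open>With \<open>a = - \<gamma>\<close> and \<open>b = \<alpha>\<close> one further coset
  takes all residual translations, and nothing moves in the subgroup.\<close>

lemma rooted_complementary:
  assumes "x = \<alpha> + p * i" "z = \<gamma> + p * j" "\<alpha> + \<gamma> + 2 = p" "\<alpha> > 0" "\<gamma> > 0"
  shows "rooted (Zmod_power p k) x z"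
proof -
  have "block (int p) (int p - int \<gamma>) (int \<alpha>) \<alpha> \<gamma>"
    using assms p by (intro blockI) (auto simp: algebra_simps)
  moreover have "base_block (int p) (int p - int \<gamma>) (int \<alpha>) 0 0"
    using assms p by (intro base_block_trivial) auto
  ultimately show ?thesis using p k total assms
    by (intro rooted_Zmod_of_blocks[where bs = "[(\<alpha>, \<gamma>)]" and i = i and j = j]) auto
qed


text \<open>The residue \<open>0\<close> of \<open>z\<close> is replaced by a full \<open>p\<close>,
  borrowed from one coset of \<open>Z\<close> and distributed as \<open>1 + (p - 2) + 1\<close>;
  hence \<open>z\<close> must be positive.\<close>

lemma rooted_complementary_zero:
  assumes x: "x = p - 2 + p * i" and z: "z = p * Suc j"
  shows "rooted (Zmod_power p k) x z"
proof -
  have "odd p" using p prime_odd_nat[of p] by simp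
  then obtain q where q: "p = 2 * q + 1" by (auto elim: oddE)
  have base: "base_block (int p) 1 (int q + 1) (q - 1 - 1) 1"
    using q p by (intro base_block_half) auto
  have 1: "block (int p) 1 (int q + 1) 1 (p - 2)" and 2: "block (int p) 1 (int q + 1) q 1"
  proof -
    have d: "int p dvd int 1 * 1 + int (p - 2) * (int q + 1)"
      by (rule dvdI[of _ _ "int q"]) (use q p in \<open>simp add: of_nat_diff algebra_simps\<close>)
    show "block (int p) 1 (int q + 1) 1 (p - 2)" by (rule blockI[OF _ _ _ _ _ d]) (use q p in auto)
    have d: "int p dvd int q * 1 + int 1 * (int q + 1)"
      by (rule dvdI[of _ _ 1]) (use q in simp)
    show "block (int p) 1 (int q + 1) q 1" by (rule blockI[OF _ _ _ _ _ d]) (use q p in auto)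
  qed
  show ?thesis using p k total x z q 1 2
    by (intro rooted_Zmod_of_blocks[OF _ _ total base, where bs = "[(1, p - 2), (q, 1)]" and i = i and j = j]) auto
qed

text \<open>Choosing \<open>b\<close> as half of \<open>a\<close> lets the base block end with a
  single translation by \<open>b\<close>; the other \<open>p - 2\<close> balance one translation by
  \<open>a\<close> in a further coset.\<close>

lemma rooted_top_small:
  assumes "x = \<alpha> + p * i" "z = p - 1 + p * j" "0 < \<alpha>" "2 * \<alpha> + 3 \<le> p"
  shows "rooted (Zmod_power p k) x z"
proof -
  have "odd p" using p prime_odd_nat[of p] by simp
  then obtain q where q: "p = 2 * q + 1" by (auto elim: oddE)
  have base: "base_block (int p) 1 (int q + 1) (\<alpha> - 1) 1"
    using q assms by (intro base_block_half) auto
  have d: "int p dvd int 1 * 1 + int (p - 2) * (int q + 1)"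
    by (rule dvdI[of _ _ "int q"]) (use q p in \<open>simp add: of_nat_diff algebra_simps\<close>)
  have 1: "block (int p) 1 (int q + 1) 1 (p - 2)" by (rule blockI[OF _ _ _ _ _ d]) (use q p in auto)
  show ?thesis using p k total assms 1
    by (intro rooted_Zmod_of_blocks[OF _ _ total base, where bs = "[(1, p - 2)]" and i = i and j = j]) auto
qed

lemma rooted_top_large:
  assumes x: "x = \<alpha> + p * i" and z: "z = p - 1 + p * j" and \<alpha>: "p < 2 * \<alpha> + 3" "\<alpha> + 4 \<le> p"
  shows "rooted (Zmod_power p k) x z"
proof -
  have "odd p" using p prime_odd_nat[of p] by simp
  then obtain q' where "p = 2 * q' + 1" by (auto elim: oddE)
  define q where "q = int q'"
  have q: "int p = 2 * q + 1" using \<open>p = 2 * q' + 1\<close> by (simp add: q_def)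
  \<comment> \<open>The base block and the further block together contain
    \<open>2 * q + 3 - (n + h)\<close> translations by \<open>a\<close>, so \<open>n + h\<close>
    must be \<open>s\<close>; \<open>h\<close> absorbs the parity of \<open>s\<close>. The value
    \<open>r\<close> is the largest that \<open>base_block_three\<close> admits, which keeps
    \<open>x2\<close> nonnegative.\<close>
  define s where "s = 2 * q + 3 - int \<alpha>"
  define n where "n = s div 2"
  define h where "h = s - n"
  define r where "r = (2 * n - 5) div 3"
  have s: "6 \<le> s" "s \<le> q + 3" using \<alpha> q by (auto simp: s_def)
  have nh: "3 \<le> n" "n \<le> q" "h = n \<or> h = n + 1" "h \<le> q" "n + h = s"
    using s unfolding n_def h_def by presburger+
  have r: "0 \<le> r" "3 * r + 5 \<le> 2 * n" "2 * n \<le> 3 * r + 7" using nh unfolding r_def by presburger+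
  define x1 where "x1 = 2 * n - 5 - 3 * r + q - h"
  define z1 where "z1 = 2 + r + q - n"
  define x2 where "x2 = q + 8 - 3 * n + 3 * r"
  define z2 where "z2 = q + n - 2 - r"
  have nonneg: "x1 \<ge> 0" "z1 \<ge> 0" "x2 \<ge> 0" "z2 \<ge> 0" using nh r by (auto simp: x1_def z1_def x2_def z2_def)
  have base: "base_block (int p) 1 3 (nat x1) (nat z1)"
    unfolding x1_def z1_def using base_block_three[OF q nh(1-4) r(1,2)] .
  have "x2 * 1 + z2 * 3 = int p * 2" using q by (simp add: x2_def z2_def)
  moreover have "x2 + z2 \<le> int p" using q r nh by (simp add: x2_def z2_def)
  ultimately have blk: "block (int p) 1 3 (nat x2) (nat z2)"
    using p nonneg by (intro blockI) auto
  have "x1 + x2 = int \<alpha>" "z1 + z2 = int p - 1"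
    using nh q by (auto simp: x1_def x2_def z1_def z2_def s_def)
  then have "nat x1 + nat x2 = \<alpha>" "nat z1 + nat z2 = p - 1" using nonneg by auto
  then show ?thesis using p k total x z \<alpha> blk
    by (intro rooted_Zmod_of_blocks[OF _ _ total base, where bs = "[(nat x2, nat z2)]" and i = i and j = j]) auto
qed

text \<open>For \<open>b = - 3 * a\<close> the residues split into two equal zero-sum blocks. With
  the subgroup they occupy three cosets, which \<open>Y\<close> has to fill up with
  \<open>p + 1\<close> labels; \<open>y \<ge> 2\<close> suffices since \<open>y\<close> is congruent
  to \<open>1\<close> modulo \<open>p\<close>.\<close>

lemma rooted_top_third_last:
  assumes x: "x = p - 3 + p * i" and z: "z = p - 1 + p * j" and y: "y \<ge> 2"
  shows "rooted (Zmod_power p k) x z"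
proof -
  have "odd p" using p prime_odd_nat[of p] by simp
  then obtain q where q: "p = 2 * q + 1" by (auto elim: oddE)
  have base: "base_block (int p) 1 (int p - 3) 0 0"
    using p by (intro base_block_trivial) auto
  have d: "int p dvd int (q - 1) * 1 + int q * (int p - 3)"
    by (rule dvdI[of _ _ "int q - 1"]) (use q p in \<open>simp add: of_nat_diff algebra_simps\<close>)
  have 1: "block (int p) 1 (int p - 3) (q - 1) q" by (rule blockI[OF _ _ _ _ _ d]) (use q p in auto)
  show ?thesis using p k total x z y q 1
    by (intro rooted_Zmod_of_blocks[OF _ _ total base, where bs = "[(q - 1, q), (q - 1, q)]" and i = i and j = j]) auto
qed

text \<open>For \<open>b = - 2 * a\<close> the pair \<open>(2 * w, w)\<close> sums to zero and the
  rest sums to \<open>- p\<close>; taking \<open>w\<close> near \<open>p / 3\<close> keeps both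
  blocks within a coset. Three cosets are occupied and \<open>Y\<close> fills the other
  \<open>p\<close> places, so it must not be empty.\<close>

lemma rooted_top_second_last:
  assumes x: "x = p - 2 + p * i" and z: "z = p - 1 + p * j" and y: "y \<ge> 1"
  shows "rooted (Zmod_power p k) x z"
proof -
  define w where "w = p div 3"
  have w: "3 * w \<le> p" "p \<le> 3 * w + 2" by (auto simp: w_def)
  have base: "base_block (int p) 1 (int p - 2) 0 0"
    using p by (intro base_block_trivial) auto
  have d: "int p dvd int (2 * w) * 1 + int w * (int p - 2)"
    by (rule dvdI[of _ _ "int w"]) (simp add: algebra_simps)
  have 1: "block (int p) 1 (int p - 2) (2 * w) w" by (rule blockI[OF _ _ _ _ _ d]) (use w p in auto)
  have d: "int p dvd int (p - 2 - 2 * w) * 1 + int (p - 1 - w) * (int p - 2)"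
    by (rule dvdI[of _ _ "int p - 2 - int w"]) (use w p in \<open>simp add: of_nat_diff algebra_simps\<close>)
  have 2: "block (int p) 1 (int p - 2) (p - 2 - 2 * w) (p - 1 - w)"
    by (rule blockI[OF _ _ _ _ _ d]) (use w p in auto)
  show ?thesis using p k total x z y w 1 2
    by (intro rooted_Zmod_of_blocks[OF _ _ total base,
          where bs = "[(2 * w, w), (p - 2 - 2 * w, p - 1 - w)]" and i = i and j = j]) auto
qed

lemma rooted_no_left:
  assumes x: "x = 0" and z: "z = p - 2 + p * j"
  shows "rooted (Zmod_power p k) x z"
proof -
  let ?G = "Zmod_power p k"
  have p0: "p > 0" using p by simp
  interpret coset_coordinates ?G "int p" "{r \<in> carrier ?G. r 0 = 0}" "\<one>\<^bsub>?G\<^esub>" "\<lambda>i r. r(0 := i)"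
    by (rule coset_coordinates_Zmod_power[OF p0 k])
  let ?R = "{r \<in> carrier ?G. r 0 = 0}"
  define N where "N = card ?R"
  have R: "N * p = p ^ k" unfolding N_def
    using bij_betw_same_card[OF bij_h] by (simp add: card_cartesian_product card_Zmod_power[OF p0])
  have c: "(y + 1) + p * (j + 1) = N * p" unfolding R total[symmetric] x z using p by simp
  have "p dvd (y + 1) + p * (j + 1)" unfolding c by simp
  then have "p dvd y + 1" by (simp only: dvd_add_left_iff dvd_triv_left)
  then obtain m where m: "y + 1 = p * m" by auto
  then obtain l where "m = Suc l" by (cases m) auto
  then have "p * (j + l + 2) = p * N" using c m by (simp add: algebra_simps)
  then have "j + l + 2 = card ?R" unfolding N_def[symmetric] using p0 by (simp only: nat_mult_eq_cancel1)
  from rooted_no_translation_by_a[OF _ this] show ?thesis using p x z by simp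
qed

end

section \<open>Case analysis over the residues\<close>

theorem theorem5:
  fixes p k \<alpha> \<beta> \<gamma> :: nat
    and V X Y Z :: "'v set" and E :: "'v set set" and s1 s2 s3 :: 'v
  assumes "prime p" and "p \<ge> 5" and "k > 1"
    and "caterpillar3 V E s1 s2 s3 X Y Z"
    and "card V = p ^ k"
    and "\<alpha> = card X mod p" and "\<beta> = card Y mod p" and "\<gamma> = card Z mod p"
  shows "rainbow (Zmod_power p k) V E \<longleftrightarrow>
    \<not> ((\<beta> = p - 2 \<and> ((\<alpha> = 0 \<and> \<gamma> = p - 1) \<or> (\<alpha> = p - 1 \<and> \<gamma> = 0))) \<or>
       (card Y = 0 \<and> ((\<alpha> = p - 1 \<and> \<gamma> = p - 2) \<or> (\<alpha> = p - 2 \<and> \<gamma> = p - 1))) \<or>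
       (card Y = 1 \<and> ((\<alpha> = p - 1 \<and> \<gamma> = p - 3) \<or> (\<alpha> = p - 3 \<and> \<gamma> = p - 1))))"
proof -
  let ?G = "Zmod_power p k"
  interpret comm_group ?G by (rule comm_group_Zmod_power)
  have p: "prime p" "p \<ge> 5" and k: "k > 0" and p0: "p > 0" using assms by auto
  have cG: "card (carrier ?G) = p ^ k" and fin: "finite (carrier ?G)"
    using card_Zmod_power finite_Zmod_power p0 by auto
  have ex: "x [^]\<^bsub>?G\<^esub> p = \<one>\<^bsub>?G\<^esub>" if "x \<in> carrier ?G" for x
    using Zmod_power_exponent[OF p0 that] .
  have finV: "finite V" using assms p0 by (metis card.infinite power_not_zero not_gr_zero)
  have D: "distinct [s1, s2, s3]" "{s1, s2, s3} \<inter> (X \<union> Y \<union> Z) = {}"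
      "X \<inter> Y = {}" "X \<inter> Z = {}" "Y \<inter> Z = {}" and V: "V = {s1, s2, s3} \<union> X \<union> Y \<union> Z"
    using assms(4) by (simp_all add: caterpillar3_def)
  have finX: "finite X" "finite Y" "finite Z" using finV V by auto
  have total: "card X + card Y + card Z + 3 = p ^ k"
  proof -
    have "card ({s1, s2, s3} \<union> (X \<union> (Y \<union> Z))) = 3 + (card X + (card Y + card Z))"
      using D finX by (simp add: card_Un_disjoint Int_Un_distrib)
    then show ?thesis using assms(5) V by (simp add: Un_assoc)
  qed
  have total': "card Z + card Y + card X + 3 = p ^ k" using total by simp
  \<comment> \<open>Reversing the spine exchanges \<open>X\<close> and \<open>Z\<close>, so each
    sufficient configuration is needed in one orientation only.\<close>
  have sw: "rooted ?G (card Z) (card X) \<longleftrightarrow> rooted ?G (card X) (card Z)"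
    using rainbow_iff_rooted[OF assms(4) finV] rainbow_iff_rooted[OF caterpillar3_swap[OF assms(4)] finV]
      assms(5) cG by simp
  have residues: "\<alpha> < p" "\<beta> < p" "\<gamma> < p" using assms p0 by simp_all
  obtain i where x: "card X = \<alpha> + p * i" using assms(6) by (metis mod_mult_div_eq)
  obtain j where z: "card Z = \<gamma> + p * j" using assms(8) by (metis mod_mult_div_eq)
  obtain l where y: "card Y = \<beta> + p * l" using assms(7) by (metis mod_mult_div_eq)
  have "p dvd p ^ k" using k by (simp add: dvd_power)
  moreover have "p ^ k = (\<alpha> + \<beta> + \<gamma> + 3) + p * (i + j + l)"
    using total x y z by (simp add: algebra_simps)
  ultimately have "p dvd \<alpha> + \<beta> + \<gamma> + 3" by (simp only: dvd_add_left_iff dvd_triv_left)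
  then obtain c where c: "\<alpha> + \<beta> + \<gamma> + 3 = p * c" by auto
  have "\<alpha> + \<beta> + \<gamma> + 3 \<le> 3 * p" using residues by simp
  then have "p * c \<le> p * 3" using c by simp
  then have "c \<le> 3" using p0 by simp
  moreover have "c \<noteq> 0" using c by (metis add_is_0 mult_0_right zero_neq_numeral)
  ultimately have sum: "\<alpha> + \<beta> + \<gamma> + 3 = p \<or> \<alpha> + \<beta> + \<gamma> + 3 = 2 * p \<or> \<alpha> + \<beta> + \<gamma> + 3 = 3 * p"
    using c by (auto simp: numeral_eq_Suc le_Suc_eq)
  have necessary: "\<not> rooted ?G (card X) (card Z)"
    if "(\<beta> = p - 2 \<and> \<alpha> = 0 \<and> \<gamma> = p - 1) \<or>
       (card Y = 0 \<and> \<alpha> = p - 1 \<and> \<gamma> = p - 2) \<or> (card Y = 1 \<and> \<alpha> = p - 1 \<and> \<gamma> = p - 3)"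
    using that not_rooted_residue_0[OF fin ex, of "card X" "card Z"]
      not_rooted_no_fixed[OF fin ex, of "card X" "card Z"]
      not_rooted_one_fixed[OF fin ex p, of "card X" "card Z"] assms(6,8) p cG total by auto
  have necessary': "\<not> rooted ?G (card Z) (card X)"
    if "(\<beta> = p - 2 \<and> \<gamma> = 0 \<and> \<alpha> = p - 1) \<or>
       (card Y = 0 \<and> \<gamma> = p - 1 \<and> \<alpha> = p - 2) \<or> (card Y = 1 \<and> \<gamma> = p - 1 \<and> \<alpha> = p - 3)"
    using that not_rooted_residue_0[OF fin ex, of "card Z" "card X"]
      not_rooted_no_fixed[OF fin ex, of "card Z" "card X"]
      not_rooted_one_fixed[OF fin ex p, of "card Z" "card X"] assms(6,8) p cG total by auto
  have top: "rooted ?G u w"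
    if uw: "u = a + p * i" "w = p - 1 + p * j" "u + card Y + w + 3 = p ^ k" "0 < a" "a + 1 < p"
      "a = p - 2 \<Longrightarrow> card Y \<noteq> 0" "a = p - 3 \<Longrightarrow> card Y \<noteq> 1"
      "a = p - 3 \<Longrightarrow> card Y \<noteq> 0" for u w a i j
  proof -
    consider "2 * a + 3 \<le> p" | "p < 2 * a + 3" "a + 4 \<le> p" | "a = p - 3" | "a = p - 2"
      using uw(5) by linarith
    then show ?thesis
    proof cases
      case 1 then show ?thesis using rooted_top_small[OF p k uw(3,1,2,4)] by simp
    next
      case 2 then show ?thesis using rooted_top_large[OF p k uw(3,1,2)] by simp
    next
      case 3 then show ?thesis using rooted_top_third_last[OF p k uw(3), of i j] uw by simp
    next
      case 4 then show ?thesis using rooted_top_second_last[OF p k uw(3), of i j] uw by simp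
    qed
  qed
  have complementary: "rooted ?G u w"
    if uw: "u = p - 2 + p * i" "w = p * j" "u + card Y + w + 3 = p ^ k"
      and swap: "rooted ?G w u \<longleftrightarrow> rooted ?G u w" for u w i j
  proof (cases j)
    case 0
    \<comment> \<open>Here \<open>w = 0\<close>, so no full coset can be borrowed; the configuration
      without translations by \<open>a\<close> is used with the spine reversed.\<close>
    have "w + card Y + u + 3 = p ^ k" using uw by simp
    from rooted_no_left[OF p k this, of i] 0 show ?thesis using uw swap by simp
  next
    case (Suc j')
    then show ?thesis using rooted_complementary_zero[OF p k uw(3,1), of j'] uw(2) by simp
  qed
  have sufficient: "rooted ?G (card X) (card Z)"
    if good: "\<not> ((\<beta> = p - 2 \<and> ((\<alpha> = 0 \<and> \<gamma> = p - 1) \<or> (\<alpha> = p - 1 \<and> \<gamma> = 0))) \<or>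
       (card Y = 0 \<and> ((\<alpha> = p - 1 \<and> \<gamma> = p - 2) \<or> (\<alpha> = p - 2 \<and> \<gamma> = p - 1))) \<or>
       (card Y = 1 \<and> ((\<alpha> = p - 1 \<and> \<gamma> = p - 3) \<or> (\<alpha> = p - 3 \<and> \<gamma> = p - 1))))"
  proof -
    have "\<alpha> = p - 1 \<or> \<alpha> + 1 < p" "\<gamma> = p - 1 \<or> \<gamma> + 1 < p" "\<alpha> = 0 \<or> \<alpha> > 0" "\<gamma> = 0 \<or> \<gamma> > 0"
      "\<alpha> + \<gamma> + 3 \<le> p \<or> p < \<alpha> + \<gamma> + 2 \<or> \<alpha> + \<gamma> + 2 = p"
      "\<alpha> + \<gamma> + 2 = p \<Longrightarrow> \<alpha> = 0 \<Longrightarrow> \<gamma> = p - 2" "\<alpha> + \<gamma> + 2 = p \<Longrightarrow> \<gamma> = 0 \<Longrightarrow> \<alpha> = p - 2"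
      using residues by linarith+
    then consider "\<alpha> + \<gamma> + 3 \<le> p" | "\<alpha> = p - 1" "\<gamma> = p - 1"
      | "\<alpha> + 1 < p" "\<gamma> + 1 < p" "p < \<alpha> + \<gamma> + 2"
      | "\<alpha> + \<gamma> + 2 = p" "\<alpha> > 0" "\<gamma> > 0" | "\<alpha> = 0" "\<gamma> = p - 2" | "\<gamma> = 0" "\<alpha> = p - 2"
      | "\<gamma> = p - 1" "\<alpha> + 1 < p" "\<alpha> > 0" | "\<alpha> = p - 1" "\<gamma> + 1 < p" "\<gamma> > 0"
      | "\<alpha> = 0" "\<gamma> = p - 1" | "\<gamma> = 0" "\<alpha> = p - 1"
      by blast
    then show ?thesis
    proof cases
      case 1 then show ?thesis using rooted_small_sum[OF p k total x z] by simp
    next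
      case 2 then show ?thesis using rooted_maximal[OF p k total, of i j] x z by simp
    next
      case 3 then show ?thesis using rooted_large_sum[OF p k total x z] by simp
    next
      case 4 then show ?thesis using rooted_complementary[OF p k total x z] by simp
    next
      case 5 then show ?thesis using complementary[OF _ _ total', of j i] x z sw by simp
    next
      case 6 then show ?thesis using complementary[OF _ _ total, of i j] x z sw by simp
    next
      case 7
      \<comment> \<open>Divisibility of the total by \<open>p\<close> determines
        \<open>\<beta>\<close>. For \<open>\<alpha> = p - 3\<close> this already excludes an empty
        \<open>Y\<close>; the other two bounds on \<open>card Y\<close> come from
        \<open>good\<close>.\<close>
      then have "\<alpha> = p - 2 \<Longrightarrow> \<beta> = 0" "\<alpha> = p - 3 \<Longrightarrow> \<beta> = 1" using sum residues by linarith+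
      then have Y: "\<alpha> = p - 2 \<Longrightarrow> card Y \<noteq> 0" "\<alpha> = p - 3 \<Longrightarrow> card Y \<noteq> 1" "\<alpha> = p - 3 \<Longrightarrow> card Y \<noteq> 0"
        using good 7 y by simp_all
      show ?thesis by (rule top[OF _ _ total _ _ Y]) (use x z 7 in simp_all)
    next
      case 8
      then have "\<gamma> = p - 2 \<Longrightarrow> \<beta> = 0" "\<gamma> = p - 3 \<Longrightarrow> \<beta> = 1" using sum residues by linarith+
      then have Y: "\<gamma> = p - 2 \<Longrightarrow> card Y \<noteq> 0" "\<gamma> = p - 3 \<Longrightarrow> card Y \<noteq> 1" "\<gamma> = p - 3 \<Longrightarrow> card Y \<noteq> 0"
        using good 8 y by simp_all
      have "rooted ?G (card Z) (card X)" by (rule top[OF _ _ total' _ _ Y]) (use x z 8 in simp_all)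
      then show ?thesis using sw by simp
    next
      case 9
      \<comment> \<open>These residues of \<open>X\<close> and \<open>Z\<close> leave no other value
        for \<open>\<beta>\<close>, so the case is always exceptional.\<close>
      then have "\<beta> = p - 2" using sum residues by linarith
      then show ?thesis using good 9 by simp
    next
      case 10
      then have "\<beta> = p - 2" using sum residues by linarith
      then show ?thesis using good 10 by simp
    qed
  qed
  have iff: "rainbow ?G V E \<longleftrightarrow> rooted ?G (card X) (card Z)"
    using rainbow_iff_rooted[OF assms(4) finV] assms(5) cG by simp
  show ?thesis
  proof (cases "rooted ?G (card X) (card Z)")
    case True
    then have "rooted ?G (card Z) (card X)" using sw by simp
    then show ?thesis using iff True necessary necessary' by argo
  next
    case False
    show ?thesis unfolding iff
    proof (rule iffI, goal_cases)
      case 1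
      with False show ?case by (rule notE)
    next
      case 2
      then show ?case by (rule sufficient)
    qed
  qed
qed

end
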